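(* Let $d\ge2$. Any general sum of squares of degree $2d$ in $\mathbb{R}[x_1,x_2,x_3]$ vanishing in $\binom{d+1}{2}$ general points of $\mathbb{P}^2(\mathbb{R})$ has sos length $d+1$. Therefore $p(3,2d)\ge d+1$.
   Context: Let $\mathbb{R}[\mathtt{x}]_e$ denote the space of forms of degree $e$ in $\mathbb{R}[x_1,\dots,x_n]$. Let $\Sigma_{n,2d}\subseteq\mathbb{R}[\mathtt{x}]_{2d}$ be the set of forms of degree $2d$ that are finite sums of squares of forms in $\mathbb{R}[\mathtt{x}]_d$. For $f\in\Sigma_{n,2d}$ the sos length $\ell(f)$ is the smallest $r\ge0$ such that $f=p_1^2+\cdots+p_r^2$ for some $p_1,\dots,p_r\in\mathbb{R}[\mathtt{x}]_d$, and $p(n,2d)=\sup\{\ell(f)\colon f\in\Sigma_{n,2d}\}$. A statement holds for $s$ general points of $\mathbb{P}^2(\mathbb{R})$ if it holds for all $s$-tuples in a nonempty Zariski open subset of $\mathbb{P}^2(\mathbb{R})^s$. Given a finite set $Z\subseteq\mathbb{P}^2(\mathbb{R})$, a statement holds for a general sum of squares of degree $2d$ vanishing on $Z$ if it holds for all $f$ in the convex cone $\{f\in\Sigma_{3,2d}\colon f|_Z=0\}$ outside a proper algebraic subset of the linear span of that cone. *)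

theory Defs
  imports
    "HOL-Analysis.Analysis"
    "HOL-Analysis.Finite_Function_Topology"
    "HOL-Library.Poly_Mapping"
    "HOL-Library.Extended_Nat"
begin

section \<open>Real polynomials and forms\<close>

text \<open>
  A polynomial with variables indexed by the type \<open>'v\<close> maps each exponent vector to its
  coefficient. Ring structure and real vector space structure are those of
  \<^theory>\<open>HOL-Library.Poly_Mapping\<close> and \<^theory>\<open>HOL-Analysis.Finite_Function_Topology\<close>.
\<close>

type_synonym 'v rpoly = "('v \<Rightarrow>\<^sub>0 nat) \<Rightarrow>\<^sub>0 real"

definition poly_value :: "'v rpoly \<Rightarrow> ('v \<Rightarrow> real) \<Rightarrow> real" where
  "poly_value p x =
     (\<Sum>m\<in>Poly_Mapping.keys p.
        Poly_Mapping.lookup p m * (\<Prod>v\<in>Poly_Mapping.keys m. x v ^ Poly_Mapping.lookup m v))"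

text \<open>The forms of degree \<open>e\<close> in \<open>n = CARD('n)\<close> variables, including the zero form.\<close>

definition forms :: "nat \<Rightarrow> 'n::finite rpoly set" where
  "forms e = {p. \<forall>m\<in>Poly_Mapping.keys p. (\<Sum>i\<in>UNIV. Poly_Mapping.lookup m i) = e}"


section \<open>Sums of squares\<close>

definition sum_of_squares :: "nat \<Rightarrow> nat \<Rightarrow> 'n::finite rpoly \<Rightarrow> bool" where
  "sum_of_squares d r f \<longleftrightarrow>
     (\<exists>p. (\<forall>i<r. p i \<in> forms d) \<and> f = (\<Sum>i<r. (p i)\<^sup>2))"

text \<open>
  In the following three definitions the argument \<open>d\<close> is half the degree: they are
  \<open>\<Sigma>\<close>, the sos length \<open>\<ell>\<close> and \<open>p(n,2d)\<close> for forms of degree \<open>2d\<close>.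
\<close>

definition sos_cone :: "nat \<Rightarrow> 'n::finite rpoly set" where
  "sos_cone d = {f \<in> forms (2 * d). \<exists>r. sum_of_squares d r f}"

definition sos_length :: "nat \<Rightarrow> 'n::finite rpoly \<Rightarrow> nat" where
  "sos_length d f = (LEAST r. sum_of_squares d r f)"

definition sos_length_sup :: "'n::finite itself \<Rightarrow> nat \<Rightarrow> enat" where
  "sos_length_sup TYPE('n) d = (SUP f\<in>(sos_cone d :: 'n rpoly set). enat (sos_length d f))"


section \<open>Projective space and general points\<close>

text \<open>Points of the projective space of dimension \<open>CARD('n) - 1\<close> are lines through the origin.\<close>

definition proj_space :: "(real ^ 'n::finite) set set" where
  "proj_space = {L. subspace L \<and> dim L = 1}"

definition vanishes_at :: "'n::finite rpoly \<Rightarrow> (real ^ 'n) set \<Rightarrow> bool" where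
  "vanishes_at f L \<longleftrightarrow> (\<forall>v\<in>L. poly_value f (\<lambda>i. v $ i) = 0)"

definition proj_tuples :: "nat \<Rightarrow> (nat \<Rightarrow> (real ^ 'n::finite) set) set" where
  "proj_tuples s = {..<s} \<rightarrow>\<^sub>E proj_space"

text \<open>
  Multihomogeneous polynomials on an \<open>s\<close>-fold product of projective spaces: the variable
  \<open>(j, i)\<close> is the \<open>i\<close>-th homogeneous coordinate of the \<open>j\<close>-th factor, and \<open>\<delta> j\<close> is the
  degree in the \<open>j\<close>-th group of variables.
\<close>

definition multihomogeneous :: "nat \<Rightarrow> (nat \<times> 'n::finite) rpoly \<Rightarrow> bool" where
  "multihomogeneous s q \<longleftrightarrow>
     (\<exists>\<delta>. \<forall>m\<in>Poly_Mapping.keys q.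
        Poly_Mapping.keys m \<subseteq> {..<s} \<times> UNIV \<and>
        (\<forall>j<s. (\<Sum>i\<in>UNIV. Poly_Mapping.lookup m (j, i)) = \<delta> j))"

definition vanishes_at_tuple ::
    "nat \<Rightarrow> (nat \<times> 'n::finite) rpoly \<Rightarrow> (nat \<Rightarrow> (real ^ 'n) set) \<Rightarrow> bool" where
  "vanishes_at_tuple s q z \<longleftrightarrow>
     (\<forall>v. (\<forall>j<s. v j \<in> z j - {0}) \<longrightarrow> poly_value q (\<lambda>(j, i). v j $ i) = 0)"

definition zariski_closed_tuples :: "nat \<Rightarrow> (nat \<Rightarrow> (real ^ 'n::finite) set) set \<Rightarrow> bool" where
  "zariski_closed_tuples s C \<longleftrightarrow>
     (\<exists>Q. (\<forall>q\<in>Q. multihomogeneous s q) \<and>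
          C = {z \<in> proj_tuples s. \<forall>q\<in>Q. vanishes_at_tuple s q z})"

definition zariski_open_tuples :: "nat \<Rightarrow> (nat \<Rightarrow> (real ^ 'n::finite) set) set \<Rightarrow> bool" where
  "zariski_open_tuples s U \<longleftrightarrow>
     U \<subseteq> proj_tuples s \<and> zariski_closed_tuples s (proj_tuples s - U)"

definition for_general_points ::
    "nat \<Rightarrow> ((nat \<Rightarrow> (real ^ 'n::finite) set) \<Rightarrow> bool) \<Rightarrow> bool" where
  "for_general_points s P \<longleftrightarrow>
     (\<exists>U. zariski_open_tuples s U \<and> U \<noteq> {} \<and> (\<forall>z\<in>U. P z))"


section \<open>General sums of squares vanishing on a set of points\<close>

definition sos_vanishing :: "nat \<Rightarrow> (real ^ 'n::finite) set set \<Rightarrow> 'n rpoly set" where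
  "sos_vanishing d Z = {f \<in> sos_cone d. \<forall>L\<in>Z. vanishes_at f L}"

text \<open>
  Algebraic subsets of a linear space \<open>V\<close> of polynomials are cut out by polynomial conditions
  on the coefficients; the variables of the polynomials in \<open>Q\<close> are indexed by monomials.
\<close>

definition algebraic_subset :: "'n::finite rpoly set \<Rightarrow> 'n rpoly set \<Rightarrow> bool" where
  "algebraic_subset V A \<longleftrightarrow>
     (\<exists>Q :: ('n \<Rightarrow>\<^sub>0 nat) rpoly set.
        A = {f \<in> V. \<forall>q\<in>Q. poly_value q (Poly_Mapping.lookup f) = 0})"

definition for_general_sos ::
    "nat \<Rightarrow> (real ^ 'n::finite) set set \<Rightarrow> ('n rpoly \<Rightarrow> bool) \<Rightarrow> bool" where
  "for_general_sos d Z P \<longleftrightarrow>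
     (\<exists>A. algebraic_subset (span (sos_vanishing d Z)) A \<and>
          A \<noteq> span (sos_vanishing d Z) \<and>
          (\<forall>f \<in> sos_vanishing d Z - A. P f))"

end

theory Submission
  imports Defs "HOL-Computational_Algebra.Polynomial"
begin

text \<open>
  Let \<open>V\<close> be the space of forms of degree \<open>d\<close> vanishing at the given points. A sum of squares that
  vanishes there is a sum of squares of elements of \<open>V\<close>. If \<open>dim V = d + 1\<close> and multiplication is
  injective on the symmetric square of \<open>V\<close>, then such an \<open>f\<close> has a unique Gram matrix, which
  depends linearly on \<open>f\<close>; the length of \<open>f\<close> is at most \<open>d + 1\<close>, and it is less than \<open>d + 1\<close> only if
  the Gram matrix is singular. Both hypotheses say that a linear system with coefficients
  multihomogeneous in the points has only the trivial solution, which is an open condition, so one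
  configuration suffices. For the pairwise intersections of \<open>d + 1\<close> tangent lines of a conic,
  the plane is parametrized by unordered pairs \<open>{a, b}\<close>, a basis of \<open>V\<close> is \<open>L\<^sub>k(a) L\<^sub>k(b)\<close> with the
  Lagrange polynomials \<open>L\<^sub>k\<close>, and a relation
  \<open>\<Sum> \<beta>\<^sub>k\<^sub>l L\<^sub>k(a) L\<^sub>l(a) L\<^sub>k(b) L\<^sub>l(b) = 0\<close> is killed by evaluating it and its derivative
  \<open>\<partial>\<^sub>a \<partial>\<^sub>b\<close> at the nodes.
\<close>

section \<open>Values of polynomials and forms\<close>

abbreviation monom_value :: "('v \<Rightarrow>\<^sub>0 nat) \<Rightarrow> ('v \<Rightarrow> real) \<Rightarrow> real" where
  "monom_value m x \<equiv> \<Prod>v\<in>Poly_Mapping.keys m. x v ^ Poly_Mapping.lookup m v"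

lemma monom_value_superset:
  assumes "finite S" "Poly_Mapping.keys m \<subseteq> S"
  shows "monom_value m x = (\<Prod>v\<in>S. x v ^ Poly_Mapping.lookup m v)"
  by (rule prod.mono_neutral_left) (use assms in \<open>auto simp: in_keys_iff\<close>)

lemma monom_value_add: "monom_value (m + n) x = monom_value m x * monom_value n x"
proof -
  let ?S = "Poly_Mapping.keys m \<union> Poly_Mapping.keys n"
  have "monom_value k x = (\<Prod>v\<in>?S. x v ^ Poly_Mapping.lookup k v)" if "k \<in> {m, n, m + n}" for k
    using that keys_add[of m n] by (intro monom_value_superset) auto
  from this[of m] this[of n] this[of "m + n"] show ?thesis
    by (simp only: insert_iff simp_thms lookup_add power_add prod.distrib)
qed

lemma poly_value_superset:
  assumes "finite S" "Poly_Mapping.keys p \<subseteq> S"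
  shows "poly_value p x = (\<Sum>m\<in>S. Poly_Mapping.lookup p m * monom_value m x)"
  unfolding poly_value_def
  by (rule sum.mono_neutral_left) (use assms in \<open>auto simp: in_keys_iff\<close>)

lemma poly_value_0 [simp]: "poly_value 0 x = 0"
  by (simp add: poly_value_def)

lemma poly_value_add: "poly_value (p + q) x = poly_value p x + poly_value q x"
proof -
  let ?S = "Poly_Mapping.keys p \<union> Poly_Mapping.keys q"
  have "Poly_Mapping.keys (p + q) \<subseteq> ?S" by (rule keys_add)
  then show ?thesis
    by (simp add: poly_value_superset[of ?S] lookup_add algebra_simps sum.distrib)
qed

lemma poly_value_diff: "poly_value (p - q) x = poly_value p x - poly_value q x"
  using poly_value_add[of "p - q" q x] by simp

lemma poly_value_sum: "poly_value (\<Sum>i\<in>I. p i) x = (\<Sum>i\<in>I. poly_value (p i) x)"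
  by (induction I rule: infinite_finite_induct) (auto simp: poly_value_add)

lemma poly_value_single: "poly_value (Poly_Mapping.single m a) x = a * monom_value m x"
  by (subst poly_value_superset[of "{m}"]) auto

lemma poly_mapping_expand:
  "p = (\<Sum>m\<in>Poly_Mapping.keys p. Poly_Mapping.single m (Poly_Mapping.lookup p m))"
  by (rule poly_mapping_eqI)
    (simp add: lookup_sum lookup_single when_def in_keys_iff)

lemma poly_value_mult: "poly_value (p * q) x = poly_value p x * poly_value q x"
proof -
  let ?s = "\<lambda>p. \<Sum>m\<in>Poly_Mapping.keys p. Poly_Mapping.single m (Poly_Mapping.lookup p m)"
  have "poly_value (?s p * ?s q) x = poly_value (?s p) x * poly_value (?s q) x"
    by (simp only: sum_product poly_value_sum mult_single poly_value_single monom_value_add)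
      (simp add: mult_ac)
  then show ?thesis
    by (simp add: poly_mapping_expand[symmetric])
qed

lemma poly_value_power: "poly_value (p ^ k) x = poly_value p x ^ k"
proof (induction k)
  case 0
  have "poly_value (Poly_Mapping.single 0 1) x = 1" by (subst poly_value_single) simp
  then show ?case by simp
qed (simp add: poly_value_mult)

text \<open>Scaling becomes a ring product with a constant polynomial, so its compatibility with
  evaluation and with products follows from the ring laws.\<close>

lemma scaleR_poly_mapping: "a *\<^sub>R p = Poly_Mapping.single 0 a * p" for p :: "'v rpoly"
proof (rule poly_mapping_eqI)
  fix m
  have "Poly_Mapping.lookup (a *\<^sub>R p) m = a * Poly_Mapping.lookup p m"
  proof -
    have "finite {x. a * Poly_Mapping.lookup p x \<noteq> 0}"
      by (rule finite_subset[of _ "Poly_Mapping.keys p"]) (auto simp: in_keys_iff)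
    then show ?thesis by (simp add: scaleR_poly_mapping_def)
  qed
  also have "\<dots> = Poly_Mapping.lookup (Poly_Mapping.map ((*) a) p) m"
    by (simp add: map.rep_eq when_def)
  finally show "Poly_Mapping.lookup (a *\<^sub>R p) m = Poly_Mapping.lookup (Poly_Mapping.single 0 a * p) m"
    by (simp add: mult_map_scale_conv_mult)
qed

lemma lookup_scaleR: "Poly_Mapping.lookup (a *\<^sub>R p) m = a * Poly_Mapping.lookup p m" for p :: "'v rpoly"
  by (simp add: scaleR_poly_mapping flip: mult_map_scale_conv_mult)
    (simp add: map.rep_eq when_def)

lemma poly_value_scaleR: "poly_value (a *\<^sub>R p) x = a * poly_value p x"
  by (simp add: scaleR_poly_mapping poly_value_mult poly_value_single)

lemma scaleR_mult_poly:
  "(a *\<^sub>R p) * q = a *\<^sub>R (p * q)" "p * (a *\<^sub>R q) = a *\<^sub>R (p * q)" for p q :: "'v rpoly"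
  by (simp_all add: scaleR_poly_mapping mult_ac)

section \<open>Forms of a fixed degree and their coefficient vectors\<close>

lemma subspace_forms: "subspace (forms e)"
proof (rule subspaceI)
  show "0 \<in> forms e" by (simp add: forms_def)
next
  fix p q :: "'n::finite rpoly" assume "p \<in> forms e" "q \<in> forms e"
  then show "p + q \<in> forms e"
    using keys_add[of p q] by (auto simp: forms_def)
next
  fix c :: real and p :: "'n::finite rpoly" assume "p \<in> forms e"
  then show "c *\<^sub>R p \<in> forms e" by (auto simp: forms_def in_keys_iff lookup_scaleR)
qed

lemma forms_mult: "p \<in> forms a \<Longrightarrow> q \<in> forms b \<Longrightarrow> p * q \<in> forms (a + b)"
  using keys_mult[of p q] by (fastforce simp: forms_def lookup_add sum.distrib)

lemma forms_power2: "p \<in> forms e \<Longrightarrow> p\<^sup>2 \<in> forms (2 * e)"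
  using forms_mult[of p e p e] by (simp add: power2_eq_square mult_2)

definition monoms :: "nat \<Rightarrow> ('n::finite \<Rightarrow>\<^sub>0 nat) set" where
  "monoms e = {m. (\<Sum>i\<in>UNIV. Poly_Mapping.lookup m i) = e}"

lemma finite_monoms [simp]: "finite (monoms e :: ('n::finite \<Rightarrow>\<^sub>0 nat) set)"
proof (rule inj_on_finite[of "Poly_Mapping.lookup"])
  show "inj_on Poly_Mapping.lookup (monoms e :: ('n \<Rightarrow>\<^sub>0 nat) set)"
    by (auto intro: inj_onI poly_mapping_eqI)
  show "Poly_Mapping.lookup ` (monoms e :: ('n \<Rightarrow>\<^sub>0 nat) set) \<subseteq> PiE UNIV (\<lambda>_. {..e})"
    by (auto simp: monoms_def intro: member_le_sum)
qed (auto intro: finite_PiE)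

lemma forms_iff: "p \<in> forms e \<longleftrightarrow> Poly_Mapping.keys p \<subseteq> monoms e"
  by (auto simp: forms_def monoms_def)

lemma poly_value_forms:
  "p \<in> forms e \<Longrightarrow> poly_value p x = (\<Sum>m\<in>monoms e. monom_value m x * Poly_Mapping.lookup p m)"
  by (simp add: poly_value_superset forms_iff mult.commute)

lemma forms_expand:
  assumes "p \<in> forms e"
  shows "p = (\<Sum>m\<in>monoms e. Poly_Mapping.lookup p m *\<^sub>R Poly_Mapping.single m 1)"
  using assms
  by (intro poly_mapping_eqI)
    (auto simp: lookup_sum lookup_single lookup_scaleR when_def forms_iff in_keys_iff if_distrib cong: if_cong)

definition form_of :: "nat \<Rightarrow> (('n::finite \<Rightarrow>\<^sub>0 nat) \<Rightarrow> real) \<Rightarrow> 'n rpoly" where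
  "form_of e c = (\<Sum>m\<in>monoms e. c m *\<^sub>R Poly_Mapping.single m 1)"

lemma lookup_form_of: "m \<in> monoms e \<Longrightarrow> Poly_Mapping.lookup (form_of e c) m = c m"
  by (simp add: form_of_def lookup_sum lookup_single lookup_scaleR when_def if_distrib cong: if_cong)

lemma form_of_in_forms: "form_of e c \<in> forms e"
  unfolding form_of_def
  by (intro subspace_sum subspace_scale subspace_forms) (simp add: forms_iff)

lemma poly_value_form_of: "poly_value (form_of e c) x = (\<Sum>m\<in>monoms e. monom_value m x * c m)"
  by (simp add: poly_value_forms[OF form_of_in_forms] lookup_form_of)

lemma monom_value_scale:
  fixes m :: "'n::finite \<Rightarrow>\<^sub>0 nat"
  assumes "m \<in> monoms e"
  shows "monom_value m (\<lambda>i. c * x i) = c ^ e * monom_value m x"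
proof -
  have "monom_value m y = (\<Prod>i\<in>UNIV. y i ^ Poly_Mapping.lookup m i)" for y :: "'n \<Rightarrow> real"
    by (rule monom_value_superset) auto
  moreover have "(\<Prod>i\<in>UNIV. c ^ Poly_Mapping.lookup m i) = c ^ e"
    using assms by (simp add: monoms_def flip: power_sum)
  ultimately show ?thesis
    by (simp only: power_mult_distrib prod.distrib)
qed

lemma poly_value_forms_scale:
  assumes "p \<in> forms e"
  shows "poly_value p (\<lambda>i. c * x i) = c ^ e * poly_value p x"
  by (simp add: poly_value_forms[OF assms] monom_value_scale sum_distrib_left mult_ac)

section \<open>Linear systems\<close>

text \<open>
  \<open>H \<delta> F\<close> stands for \<open>F\<close> being a polynomial of degree \<open>\<delta>\<close>, with \<open>pl\<close> the addition of degrees.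
  Fraction-free Gaussian elimination keeps every row of a homogeneous degree; \<open>D\<close> is the product
  of the pivots.
\<close>

lemma elimination_nonsingular:
  fixes H :: "'g \<Rightarrow> ('a \<Rightarrow> real) \<Rightarrow> bool" and c :: "'i \<Rightarrow> 'j \<Rightarrow> 'a \<Rightarrow> real"
  assumes one: "H z (\<lambda>_. 1)"
    and mult: "\<And>a b F G. H a F \<Longrightarrow> H b G \<Longrightarrow> H (pl a b) (\<lambda>v. F v * G v)"
    and diff: "\<And>a F G. H a F \<Longrightarrow> H a G \<Longrightarrow> H a (\<lambda>v. F v - G v)"
    and "finite J"
    and "\<And>i j. i \<in> I \<Longrightarrow> j \<in> J \<Longrightarrow> H (\<delta> i) (c i j)"
    and "\<And>x. (\<And>i. i \<in> I \<Longrightarrow> (\<Sum>j\<in>J. c i j v0 * x j) = 0) \<Longrightarrow> \<forall>j\<in>J. x j = 0"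
  shows "\<exists>e D. H e D \<and> D v0 \<noteq> 0 \<and>
    (\<forall>v x. D v \<noteq> 0 \<longrightarrow> (\<forall>i\<in>I. (\<Sum>j\<in>J. c i j v * x j) = 0) \<longrightarrow> (\<forall>j\<in>J. x j = 0))"
  using assms(4-)
\<comment> \<open>The induction runs over the unknowns only. The set \<open>I\<close> of equations
  may be infinite, as happens later when every point of space contributes an equation.\<close>
proof (induction J arbitrary: c \<delta> rule: finite_induct)
  case empty
  then show ?case using one by (intro exI[of _ z] exI[of _ "\<lambda>_. 1"]) auto
next
  case (insert k J)
  have "\<exists>r\<in>I. c r k v0 \<noteq> 0"
  proof (rule ccontr)
    assume "\<not> ?thesis"
    \<comment> \<open>If the column \<open>k\<close> vanished at \<open>v0\<close>, the unit vector
      at \<open>k\<close> would be a nontrivial solution.\<close>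
    then have "(\<Sum>j\<in>insert k J. c i j v0 * (if j = k then 1 else 0)) = 0" if "i \<in> I" for i
      using that by (intro sum.neutral) auto
    with insert.prems(2)[of "\<lambda>j. if j = k then 1 else 0"] show False by auto
  qed
  then obtain r where r: "r \<in> I" "c r k v0 \<noteq> 0" by blast
  \<comment> \<open>Cross-multiplication with the pivot row \<open>r\<close> avoids division, so row
    \<open>i\<close> keeps one degree for all its entries. Row \<open>r\<close> itself becomes zero
    and can stay in the system.\<close>
  define c' where "c' = (\<lambda>i j v. c r k v * c i j v - c r j v * c i k v)"
  have c'_sum: "(\<Sum>j\<in>J. c' i j v * x j) = c r k v * (\<Sum>j\<in>insert k J. c i j v * x j)
      - c i k v * (\<Sum>j\<in>insert k J. c r j v * x j)" for i v x
    using insert.hyps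
    by (simp add: c'_def sum_distrib_left sum_subtractf algebra_simps)
  have "\<exists>e D. H e D \<and> D v0 \<noteq> 0 \<and>
    (\<forall>v x. D v \<noteq> 0 \<longrightarrow> (\<forall>i\<in>I. (\<Sum>j\<in>J. c' i j v * x j) = 0) \<longrightarrow> (\<forall>j\<in>J. x j = 0))"
  proof (rule insert.IH[of "\<lambda>i. pl (\<delta> r) (\<delta> i)" c'])
    fix i j assume "i \<in> I" "j \<in> J"
    then show "H (pl (\<delta> r) (\<delta> i)) (c' i j)"
      unfolding c'_def using r(1) by (intro diff mult insert.prems(1)) auto
  next
    fix x assume x: "\<And>i. i \<in> I \<Longrightarrow> (\<Sum>j\<in>J. c' i j v0 * x j) = 0"
    \<comment> \<open>Back-substitution: the entry at \<open>k\<close> is chosen so that the pivot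
      row is satisfied.\<close>
    define y where "y = x(k := - (\<Sum>j\<in>J. c r j v0 * x j) / c r k v0)"
    have yJ: "(\<Sum>j\<in>J. f j * y j) = (\<Sum>j\<in>J. f j * x j)" for f
      using insert.hyps by (intro sum.cong) (auto simp: y_def)
    have row: "(\<Sum>j\<in>insert k J. c r j v0 * y j) = 0"
      using insert.hyps r(2) by (simp add: yJ) (simp add: y_def)
    have "\<forall>j\<in>insert k J. y j = 0"
    proof (rule insert.prems(2))
      fix i assume "i \<in> I"
      then have "c r k v0 * (\<Sum>j\<in>insert k J. c i j v0 * y j) = 0"
        using c'_sum[of i v0 y] x[of i] yJ row by simp
      then show "(\<Sum>j\<in>insert k J. c i j v0 * y j) = 0" using r(2) by simp
    qed
    moreover have "y j = x j" if "j \<in> J" for j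
      using insert.hyps that by (auto simp: y_def)
    ultimately show "\<forall>j\<in>J. x j = 0" by simp
  qed
  then obtain e D where D: "H e D" "D v0 \<noteq> 0"
    "\<And>v x. D v \<noteq> 0 \<Longrightarrow> (\<forall>i\<in>I. (\<Sum>j\<in>J. c' i j v * x j) = 0) \<Longrightarrow> (\<forall>j\<in>J. x j = 0)"
    by blast
  show ?case
  proof (intro exI conjI allI impI)
    show "H (pl (\<delta> r) e) (\<lambda>v. c r k v * D v)"
      by (intro mult insert.prems(1) D(1) r(1)) simp
    show "c r k v0 * D v0 \<noteq> 0" using r D by simp
  next
    fix v x assume nz: "c r k v * D v \<noteq> 0" and x: "\<forall>i\<in>I. (\<Sum>j\<in>insert k J. c i j v * x j) = 0"
    have "\<forall>j\<in>J. x j = 0"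
      using nz x r(1) by (intro D(3)[of v]) (auto simp: c'_sum simp del: sum.insert)
    moreover from this have "c r k v * x k = 0"
      using bspec[OF x r(1)] insert.hyps by simp
    ultimately show "\<forall>j\<in>insert k J. x j = 0" using nz by auto
  qed
qed

text \<open>Gaussian elimination by induction on the equations: an equation with a nonzero
  coefficient removes one equation and one unknown, which preserves the strict inequality of the
  cardinalities.\<close>

lemma underdetermined_system:
  fixes b :: "'i \<Rightarrow> 'j \<Rightarrow> real"
  assumes "finite I" "finite J" "card I < card J"
  shows "\<exists>x. (\<exists>j\<in>J. x j \<noteq> 0) \<and> (\<forall>i\<in>I. (\<Sum>j\<in>J. b i j * x j) = 0)"
  using assms
proof (induction I arbitrary: J b rule: finite_induct)
  case empty
  then have "J \<noteq> {}" by auto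
  then show ?case by (intro exI[of _ "\<lambda>_. 1"]) auto
next
  case (insert r I)
  show ?case
  proof (cases "\<forall>j\<in>J. b r j = 0")
    case True
    have "\<exists>x. (\<exists>j\<in>J. x j \<noteq> 0) \<and> (\<forall>i\<in>I. (\<Sum>j\<in>J. b i j * x j) = 0)"
      using insert by (intro insert.IH) auto
    with True show ?thesis by auto
  next
    case False
    then obtain k where k: "k \<in> J" "b r k \<noteq> 0" by auto
    define b' where "b' = (\<lambda>i j. b i j - b i k / b r k * b r j)"
    have "\<exists>x. (\<exists>j\<in>J - {k}. x j \<noteq> 0) \<and> (\<forall>i\<in>I. (\<Sum>j\<in>J - {k}. b' i j * x j) = 0)"
      using insert k by (intro insert.IH) auto
    then obtain x where x: "\<exists>j\<in>J - {k}. x j \<noteq> 0" "\<And>i. i \<in> I \<Longrightarrow> (\<Sum>j\<in>J - {k}. b' i j * x j) = 0"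
      by blast
    define y where "y = x(k := - (\<Sum>j\<in>J - {k}. b r j * x j) / b r k)"
    have sy: "(\<Sum>j\<in>J. f j * y j) = f k * y k + (\<Sum>j\<in>J - {k}. f j * x j)" for f
    proof -
      have "(\<Sum>j\<in>J - {k}. f j * y j) = (\<Sum>j\<in>J - {k}. f j * x j)"
        by (intro sum.cong) (auto simp: y_def)
      then show ?thesis using insert.prems k by (simp add: sum.remove)
    qed
    have 1: "(\<Sum>j\<in>J. b r j * y j) = 0" using k by (simp add: sy) (simp add: y_def)
    moreover have "(\<Sum>j\<in>J. b i j * y j) = 0" if "i \<in> I" for i
    proof -
      have "(\<Sum>j\<in>J - {k}. b i j * x j) = b i k / b r k * (\<Sum>j\<in>J - {k}. b r j * x j)"
        using x(2)[OF that] by (simp add: b'_def algebra_simps sum_subtractf sum_distrib_left)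
      moreover have "(\<Sum>j\<in>J - {k}. b r j * x j) = - (b r k * y k)" using 1 by (simp add: sy)
      ultimately show ?thesis using k by (simp add: sy)
    qed
    moreover have "\<exists>j\<in>J. y j \<noteq> 0" using x(1) by (auto simp: y_def)
    ultimately show ?thesis by (intro exI[of _ y]) auto
  qed
qed

text \<open>The negated right-hand side becomes an additional column, indexed by
  \<open>None\<close>. The enlarged system has more unknowns than equations, hence a nontrivial
  solution; injectivity forces its \<open>None\<close> entry to be nonzero, and dividing by that
  entry solves the original system.\<close>

lemma square_system_solvable:
  fixes b :: "'i \<Rightarrow> 'j \<Rightarrow> real"
  assumes "finite I" "finite J" "card I = card J"
    and inj: "\<And>x. (\<And>i. i \<in> I \<Longrightarrow> (\<Sum>j\<in>J. b i j * x j) = 0) \<Longrightarrow> \<forall>j\<in>J. x j = 0"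
  shows "\<exists>x. \<forall>i\<in>I. (\<Sum>j\<in>J. b i j * x j) = t i"
proof -
  define b' where "b' = (\<lambda>i. case_option (- t i) (b i))"
  have sJ: "(\<Sum>j\<in>insert None (Some ` J). b' i j * x j) = (\<Sum>j\<in>J. b i j * x (Some j)) - t i * x None"
    for i x
    using assms(2) by (simp add: b'_def sum.reindex)
  have "card (insert None (Some ` J)) = Suc (card J)"
    using assms(2) by (simp add: card_image)
  then have "\<exists>x. (\<exists>j\<in>insert None (Some ` J). x j \<noteq> 0) \<and>
      (\<forall>i\<in>I. (\<Sum>j\<in>insert None (Some ` J). b' i j * x j) = 0)"
    using assms by (intro underdetermined_system) auto
  then obtain x where x: "\<exists>j\<in>insert None (Some ` J). x j \<noteq> 0"
    "\<And>i. i \<in> I \<Longrightarrow> (\<Sum>j\<in>J. b i j * x (Some j)) = t i * x None"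
    unfolding sJ by auto
  have "x None \<noteq> 0"
    using x inj[of "\<lambda>j. x (Some j)"] by auto
  then show ?thesis
    using x(2) by (intro exI[of _ "\<lambda>j. x (Some j) / x None"]) (simp flip: sum_divide_distrib)
qed

text \<open>A family without linear relations is injective and has an independent image; the dual
  basis on this image extends to linear functionals on the whole space.\<close>

lemma dual_functionals:
  fixes u :: "'j \<Rightarrow> 'b::real_vector"
  assumes "finite J" "\<And>a. (\<Sum>j\<in>J. a j *\<^sub>R u j) = 0 \<Longrightarrow> \<forall>j\<in>J. a j = 0"
  shows "\<exists>\<phi> :: 'j \<Rightarrow> 'b \<Rightarrow> real. \<forall>i\<in>J. linear (\<phi> i) \<and> (\<forall>j\<in>J. \<phi> i (u j) = (if i = j then 1 else 0))"
proof -
  have inj: "inj_on u J"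
  proof (rule inj_onI)
    fix i j assume ij: "i \<in> J" "j \<in> J" "u i = u j"
    show "i = j"
    proof (rule ccontr)
      assume "i \<noteq> j"
      \<comment> \<open>Two equal members would give the relation
        \<open>u i - u j = 0\<close>.\<close>
      let ?a = "\<lambda>k. (if k = i then 1 else 0) - (if k = j then 1 else (0::real))"
      have "(\<Sum>k\<in>J. ?a k *\<^sub>R u k) = 0"
        using ij assms(1) by (simp add: algebra_simps sum_subtractf if_distrib[of "\<lambda>t. t *\<^sub>R _"] cong: if_cong)
      from assms(2)[OF this] ij \<open>i \<noteq> j\<close> show False by auto
    qed
  qed
  have "independent (u ` J)"
    unfolding independent_explicit_finite_subsets
  proof (intro allI impI ballI)
    fix T a w assume T: "T \<subseteq> u ` J" "finite T" "(\<Sum>v\<in>T. a v *\<^sub>R v) = 0" "w \<in> T"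
    let ?a = "\<lambda>j. if u j \<in> T then a (u j) else 0"
    have "(\<Sum>j\<in>J. ?a j *\<^sub>R u j) = (\<Sum>v\<in>u ` J. (if v \<in> T then a v else 0) *\<^sub>R v)"
      using inj by (simp add: sum.reindex)
    also have "\<dots> = (\<Sum>v\<in>T. a v *\<^sub>R v)"
      using T assms(1) by (intro sum.mono_neutral_cong_right) auto
    finally have "\<forall>j\<in>J. ?a j = 0" using T assms(2)[of ?a] by simp
    moreover obtain j where "j \<in> J" "w = u j" using T by auto
    ultimately show "a w = 0" using T by force
  qed
  then have "\<exists>g :: 'b \<Rightarrow> real. linear g \<and> (\<forall>x\<in>u ` J. g x = (if x = u i then 1 else 0))" for i
    by (rule linear_independent_extend)
  then obtain \<phi> :: "'j \<Rightarrow> 'b \<Rightarrow> real" where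
    "\<And>i. linear (\<phi> i)" "\<And>i x. x \<in> u ` J \<Longrightarrow> \<phi> i x = (if x = u i then 1 else 0)"
    by metis
  then show ?thesis
    using inj by (intro exI[of _ \<phi>]) (auto simp: inj_on_eq_iff)
qed

text \<open>
  Completing the square: for a unit vector \<open>u\<close> and \<open>t = \<Sum> u\<^sub>i h\<^sub>i\<close> one has
  \<open>\<Sum> h\<^sub>i\<^sup>2 = \<Sum> (h\<^sub>i - u\<^sub>i t)\<^sup>2 + t\<^sup>2\<close>, so what remains is again a sum of squares.
\<close>

lemma combination_of_squares:
  fixes p w :: "nat \<Rightarrow> 'v rpoly"
  assumes "\<And>i. i < r \<Longrightarrow> p i = (\<Sum>k<n. b i k *\<^sub>R w k)"
  shows "\<exists>q. (\<forall>k<n. q k \<in> span (w ` {..<n})) \<and> (\<Sum>i<r. (p i)\<^sup>2) = (\<Sum>k<n. (q k)\<^sup>2)"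
  using assms
proof (induction n arbitrary: p b)
  case 0
  then show ?case by simp
next
  case (Suc n)
  define a where "a = (\<lambda>i. b i n)"
  define h where "h = (\<lambda>i. \<Sum>k<n. b i k *\<^sub>R w k)"
  have p: "p i = h i + a i *\<^sub>R w n" if "i < r" for i
    using Suc.prems[OF that] by (simp add: a_def h_def)
  have mono: "span (w ` {..<n}) \<subseteq> span (w ` {..<Suc n})"
    by (intro span_mono) auto
  show ?case
  proof (cases "(\<Sum>i<r. (a i)\<^sup>2) = 0")
    case True
    then have "a i = 0" if "i < r" for i
      using that by (subst (asm) sum_nonneg_eq_0_iff) auto
    then obtain q where "\<forall>k<n. q k \<in> span (w ` {..<n})" "(\<Sum>i<r. (p i)\<^sup>2) = (\<Sum>k<n. (q k)\<^sup>2)"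
      using Suc.IH[of p b] p by (auto simp: h_def)
    \<comment> \<open>No summand involves \<open>w n\<close>, so slot \<open>n\<close> is filled
      with the zero polynomial.\<close>
    with mono show ?thesis
      by (intro exI[of _ "q(n := 0)"]) (auto simp: less_Suc_eq span_zero)
  next
    case False
    define s where "s = sqrt (\<Sum>i<r. (a i)\<^sup>2)"
    have s: "s > 0" "s\<^sup>2 = (\<Sum>i<r. (a i)\<^sup>2)"
      using False by (auto simp: s_def sum_nonneg less_le)
    define u where "u = (\<lambda>i. a i / s)"
    have a: "a i = s * u i" for i using s by (simp add: u_def)
    have u: "(\<Sum>i<r. u i * u i) = 1"
      proof -
      have "(\<Sum>i<r. u i * u i) = (\<Sum>i<r. (a i)\<^sup>2) / s\<^sup>2"
        by (simp add: u_def power_divide sum_divide_distrib flip: power2_eq_square)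
      then show ?thesis using s(1) by (simp flip: s(2))
    qed
    define t where "t = (\<Sum>i<r. u i *\<^sub>R h i)"
    have "\<exists>q. (\<forall>k<n. q k \<in> span (w ` {..<n})) \<and> (\<Sum>i<r. (h i - u i *\<^sub>R t)\<^sup>2) = (\<Sum>k<n. (q k)\<^sup>2)"
    proof (rule Suc.IH[of _ "\<lambda>i k. b i k - u i * (\<Sum>j<r. u j * b j k)"])
      fix i assume "i < r"
      have "t = (\<Sum>k<n. (\<Sum>j<r. u j * b j k) *\<^sub>R w k)"
        unfolding t_def h_def
        by (simp add: scaleR_right.sum scaleR_left.sum) (rule sum.swap)
      then show "h i - u i *\<^sub>R t = (\<Sum>k<n. (b i k - u i * (\<Sum>j<r. u j * b j k)) *\<^sub>R w k)"
        by (simp add: h_def scaleR_diff_left sum_subtractf scaleR_right.sum)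
    qed
    then obtain q where q: "\<forall>k<n. q k \<in> span (w ` {..<n})"
      "(\<Sum>i<r. (h i - u i *\<^sub>R t)\<^sup>2) = (\<Sum>k<n. (q k)\<^sup>2)" by blast
    have uh: "(\<Sum>i<r. u i *\<^sub>R (h i * g)) = t * g" for g
      by (simp add: t_def sum_distrib_right scaleR_mult_poly)
    \<comment> \<open>After expansion, the terms that contain \<open>w n\<close> combine with the
      \<open>t\<^sup>2\<close> split off below into the square of
      \<open>t + s *\<^sub>R w n\<close>, which becomes entry \<open>n\<close> of the new
      family.\<close>
    have "(\<Sum>i<r. (p i)\<^sup>2) = (\<Sum>i<r. (h i)\<^sup>2 + s *\<^sub>R (u i *\<^sub>R (h i * w n) + u i *\<^sub>R (h i * w n)) + (s\<^sup>2 * (u i * u i)) *\<^sub>R (w n)\<^sup>2)"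
      by (intro sum.cong)
        (simp_all add: p a power2_eq_square scaleR_mult_poly algebra_simps)
    also have "\<dots> = (\<Sum>i<r. (h i)\<^sup>2) + s *\<^sub>R (t * w n + t * w n) + s\<^sup>2 *\<^sub>R (w n)\<^sup>2"
      by (simp add: sum.distrib uh u flip: scaleR_right.sum scaleR_left.sum sum_distrib_left)
    also have "(\<Sum>i<r. (h i)\<^sup>2) = (\<Sum>i<r. (h i - u i *\<^sub>R t)\<^sup>2) + t\<^sup>2"
    proof -
      have "(\<Sum>i<r. (h i - u i *\<^sub>R t)\<^sup>2) = (\<Sum>i<r. (h i)\<^sup>2 - (u i *\<^sub>R (h i * t) + u i *\<^sub>R (h i * t)) + (u i * u i) *\<^sub>R t\<^sup>2)"
        by (intro sum.cong)
          (simp_all add: power2_eq_square scaleR_mult_poly algebra_simps scaleR_add_left flip: scaleR_add_right mult_2 mult_2_right)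
      also have "\<dots> = (\<Sum>i<r. (h i)\<^sup>2) - (t * t + t * t) + t\<^sup>2"
        by (simp only: sum.distrib sum_subtractf uh u scaleR_one flip: scaleR_left.sum)
      finally show ?thesis by (simp add: power2_eq_square)
    qed
    also note q(2)
    finally have "(\<Sum>i<r. (p i)\<^sup>2) = (\<Sum>k<n. (q k)\<^sup>2) + (t + s *\<^sub>R w n)\<^sup>2"
      by (simp add: power2_eq_square scaleR_mult_poly algebra_simps)
    moreover have "h i \<in> span (w ` {..<Suc n})" for i
      unfolding h_def by (intro span_sum span_scale span_base) auto
    then have "t + s *\<^sub>R w n \<in> span (w ` {..<Suc n})"
      unfolding t_def by (intro span_add span_sum span_scale) (auto intro: span_base)
    ultimately show ?thesis
      using q(1) mono by (intro exI[of _ "q(n := t + s *\<^sub>R w n)"]) (auto simp: less_Suc_eq)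
  qed
qed

section \<open>Gram matrices of sums of squares\<close>

text \<open>Real squares cannot cancel. This forces the summands of a sum of squares vanishing at a
  point to vanish there too.\<close>

lemma poly_value_square_sum_eq_0:
  fixes p :: "nat \<Rightarrow> 'v rpoly"
  assumes "poly_value (\<Sum>i<r. (p i)\<^sup>2) x = 0" "i < r"
  shows "poly_value (p i) x = 0"
proof -
  have "(\<Sum>i<r. (poly_value (p i) x)\<^sup>2) = 0"
    using assms(1) by (simp add: poly_value_sum poly_value_power)
  then have "\<forall>i\<in>{..<r}. (poly_value (p i) x)\<^sup>2 = 0"
    by (subst (asm) sum_nonneg_eq_0_iff) auto
  then show ?thesis using assms(2) by simp
qed

text \<open>
  \<open>v\<close> is a tuple of vectors, \<open>y\<close> a tuple of auxiliary vectors that completes it to a unisolvent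
  one for forms of degree \<open>d\<close>; values at \<open>y\<close> serve as coordinates on the forms vanishing at \<open>v\<close>.
\<close>

definition unisolvent ::
    "nat \<Rightarrow> nat \<Rightarrow> (nat \<Rightarrow> real ^ 'n::finite) \<Rightarrow> (nat \<Rightarrow> real ^ 'n) \<Rightarrow> bool" where
  "unisolvent d s v y \<longleftrightarrow> (\<forall>c.
     (\<forall>j<s. (\<Sum>m\<in>monoms d. monom_value m (($) (v j)) * c m) = 0) \<longrightarrow>
     (\<forall>k\<le>d. (\<Sum>m\<in>monoms d. monom_value m (($) (y k)) * c m) = 0) \<longrightarrow>
     (\<forall>m\<in>monoms d. c m = 0))"

text \<open>
  Symmetric tensors \<open>A\<close> with \<open>A e\<^sub>z = 0\<close> for the evaluation vectors \<open>e\<^sub>z\<close> at the given points are the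
  symmetric square of the space of forms vanishing there. The condition says that multiplication
  is injective on this symmetric square.
\<close>

definition square_injective :: "nat \<Rightarrow> nat \<Rightarrow> (nat \<Rightarrow> real ^ 'n::finite) \<Rightarrow> bool" where
  "square_injective d s v \<longleftrightarrow> (\<forall>A.
     (\<forall>m\<in>monoms d. \<forall>m'\<in>monoms d. A (m, m') = A (m', m)) \<longrightarrow>
     (\<forall>j<s. \<forall>m\<in>monoms d. (\<Sum>m'\<in>monoms d. monom_value m' (($) (v j)) * A (m, m')) = 0) \<longrightarrow>
     (\<forall>x. (\<Sum>(m, m')\<in>monoms d \<times> monoms d. monom_value m (($) x) * monom_value m' (($) x) * A (m, m')) = 0) \<longrightarrow>
     (\<forall>m\<in>monoms d. \<forall>m'\<in>monoms d. A (m, m') = 0))"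

lemma unisolventD:
  assumes "unisolvent d s v y"
    and "\<And>j. j < s \<Longrightarrow> (\<Sum>m\<in>monoms d. monom_value m (($) (v j)) * c m) = 0"
    and "\<And>k. k \<le> d \<Longrightarrow> (\<Sum>m\<in>monoms d. monom_value m (($) (y k)) * c m) = 0"
  shows "\<forall>m\<in>monoms d. c m = 0"
  using assms(1)[unfolded unisolvent_def, THEN spec, of c] assms(2-) by blast

lemma square_injectiveD:
  assumes "square_injective d s v"
    and "\<And>m m'. m \<in> monoms d \<Longrightarrow> m' \<in> monoms d \<Longrightarrow> A (m, m') = A (m', m)"
    and "\<And>j m. j < s \<Longrightarrow> m \<in> monoms d \<Longrightarrow> (\<Sum>m'\<in>monoms d. monom_value m' (($) (v j)) * A (m, m')) = 0"
    and "\<And>x. (\<Sum>(m, m')\<in>monoms d \<times> monoms d. monom_value m (($) x) * monom_value m' (($) x) * A (m, m')) = 0"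
  shows "\<forall>m\<in>monoms d. \<forall>m'\<in>monoms d. A (m, m') = 0"
  using assms(1)[unfolded square_injective_def, THEN spec, of A] assms(2-) by blast

text \<open>Evaluation at the \<open>s + (d + 1)\<close> points is injective on a space of the same
  dimension, hence bijective, so there are forms \<open>w k\<close> dual to the points
  \<open>y k\<close> and vanishing at all \<open>v j\<close>. They form a basis of the forms
  vanishing at \<open>v\<close>, with the values at \<open>y\<close> as coordinates.\<close>

lemma unisolvent_dual_forms:
  fixes v y :: "nat \<Rightarrow> real ^ 'n::finite"
  assumes "unisolvent d s v y" "card (monoms d :: ('n \<Rightarrow>\<^sub>0 nat) set) = s + (d + 1)"
  obtains w where "\<And>k. w k \<in> forms d" "\<And>k j. j < s \<Longrightarrow> poly_value (w k) (($) (v j)) = 0"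
    "\<And>k l. k \<le> d \<Longrightarrow> l \<le> d \<Longrightarrow> poly_value (w k) (($) (y l)) = (if k = l then 1 else 0)"
    "\<And>p. p \<in> forms d \<Longrightarrow> (\<And>j. j < s \<Longrightarrow> poly_value p (($) (v j)) = 0) \<Longrightarrow>
       p = (\<Sum>k<Suc d. poly_value p (($) (y k)) *\<^sub>R w k)"
proof -
  define pt where "pt = case_sum v y"
  define I where "I = {..<s} <+> {..d}"
  have "\<exists>c. \<forall>i\<in>I. (\<Sum>m\<in>monoms d. monom_value m (($) (pt i)) * c m) = (if i = Inr k then 1 else 0)" for k
  proof (rule square_system_solvable)
    show "card I = card (monoms d :: ('n \<Rightarrow>\<^sub>0 nat) set)"
      using assms(2) by (simp add: I_def card_Plus)
  next
    fix x assume "\<And>i. i \<in> I \<Longrightarrow> (\<Sum>m\<in>monoms d. monom_value m (($) (pt i)) * x m) = 0"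
    from this[of "Inl j" for j] this[of "Inr k" for k] show "\<forall>m\<in>monoms d. x m = 0"
      by (intro unisolventD[OF assms(1)]) (simp_all add: I_def pt_def InlI InrI)
  qed (simp_all add: I_def)
  then obtain c where c: "\<And>k i. i \<in> I \<Longrightarrow>
      (\<Sum>m\<in>monoms d. monom_value m (($) (pt i)) * c k m) = (if i = Inr k then 1 else 0)"
    using choice[of "\<lambda>k c. \<forall>i\<in>I. (\<Sum>m\<in>monoms d. monom_value m (($) (pt i)) * c m) = (if i = Inr k then 1 else 0)"]
    by blast
  define w where "w = (\<lambda>k. form_of d (c k))"
  have w: "w k \<in> forms d" for k by (simp add: w_def form_of_in_forms)
  have val: "poly_value (w k) (($) (pt i)) = (if i = Inr k then 1 else 0)" if "i \<in> I" for k i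
    using c[OF that] by (simp add: w_def poly_value_form_of)
  have wv: "poly_value (w k) (($) (v j)) = 0" if "j < s" for k j
    using val[of "Inl j" k] that by (simp add: I_def pt_def InlI)
  have wy: "poly_value (w k) (($) (y l)) = (if k = l then 1 else 0)" if "k \<le> d" "l \<le> d" for k l
    using val[of "Inr l" k] that by (simp add: I_def pt_def InrI)
  show ?thesis
  proof (rule that[OF w wv wy])
    fix p :: "'n rpoly"
    assume p: "p \<in> forms d" "\<And>j. j < s \<Longrightarrow> poly_value p (($) (v j)) = 0"
    \<comment> \<open>The interpolation error vanishes at all points of both tuples, so unisolvence
      makes it zero.\<close>
    define q where "q = p - (\<Sum>k<Suc d. poly_value p (($) (y k)) *\<^sub>R w k)"
    have q: "q \<in> forms d"
      unfolding q_def by (intro subspace_diff subspace_sum subspace_scale subspace_forms p w)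
    have qx: "poly_value q x = poly_value p x - (\<Sum>k<Suc d. poly_value p (($) (y k)) * poly_value (w k) x)" for x
    proof -
      have "poly_value p x = poly_value (q + (\<Sum>k<Suc d. poly_value p (($) (y k)) *\<^sub>R w k)) x"
        by (simp add: q_def)
      then show ?thesis by (simp only: poly_value_add poly_value_sum poly_value_scaleR)
    qed
    have "poly_value q (($) (v j)) = 0" if "j < s" for j
      using that by (simp add: qx p wv)
    moreover have "poly_value q (($) (y l)) = 0" if "l \<le> d" for l
    proof -
      have "(\<Sum>k<Suc d. poly_value p (($) (y k)) * poly_value (w k) (($) (y l))) =
          (\<Sum>k<Suc d. if k = l then poly_value p (($) (y l)) else 0)"
        using that by (intro sum.cong) (auto simp: wy)
      also have "\<dots> = poly_value p (($) (y l))"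
        using that by (subst sum.delta) auto
      finally show ?thesis by (simp only: qx)
    qed
    ultimately have "\<forall>m\<in>monoms d. Poly_Mapping.lookup q m = 0"
      unfolding poly_value_forms[OF q] by (rule unisolventD[OF assms(1)])
    moreover have "Poly_Mapping.lookup q m = 0" if "m \<notin> monoms d" for m
      using q that by (auto simp: forms_iff in_keys_iff)
    ultimately have "q = 0" by (intro poly_mapping_eqI) (metis lookup_zero)
    then show "p = (\<Sum>k<Suc d. poly_value p (($) (y k)) *\<^sub>R w k)" by (simp add: q_def)
  qed
qed

text \<open>A linear relation among the products \<open>w k * w l\<close> lifts to a symmetric
  tensor \<open>A\<close> that satisfies the hypotheses of \<open>square_injective\<close>. Hence
  \<open>A = 0\<close>, and evaluating the two slots of \<open>A\<close> at \<open>y k\<close> and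
  \<open>y l\<close> recovers the coefficients of the relation.\<close>

lemma products_independent:
  fixes v y :: "nat \<Rightarrow> real ^ 'n::finite" and w :: "nat \<Rightarrow> 'n rpoly"
  assumes inj: "square_injective d s v"
    and w: "\<And>k. w k \<in> forms d" "\<And>k j. j < s \<Longrightarrow> poly_value (w k) (($) (v j)) = 0"
    "\<And>k l. k \<le> d \<Longrightarrow> l \<le> d \<Longrightarrow> poly_value (w k) (($) (y l)) = (if k = l then 1 else 0)"
    and "(\<Sum>(k, l)\<in>{(k, l). k \<le> l \<and> l \<le> d}. a (k, l) *\<^sub>R (w k * w l)) = 0"
  shows "\<forall>i\<in>{(k, l). k \<le> l \<and> l \<le> d}. a i = 0"
proof -
  let ?J = "{(k, l). k \<le> l \<and> l \<le> d}"
  have finJ: "finite ?J" by (rule finite_subset[of _ "{..d} \<times> {..d}"]) auto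
  define W where "W = (\<lambda>k. Poly_Mapping.lookup (w k))"
  \<comment> \<open>The symmetrization of the tensor with coefficients \<open>a\<close>. Its
    restriction to equal arguments is twice the given relation.\<close>
  define A where "A = (\<lambda>(m, m'). \<Sum>(k, l)\<in>?J. a (k, l) * (W k m * W l m' + W l m * W k m'))"
  have wx: "(\<Sum>m\<in>monoms d. monom_value m x * W k m) = poly_value (w k) x" for k x
    using poly_value_forms[OF w(1)[of k], of x] by (simp add: W_def)
  have half: "(\<Sum>m'\<in>monoms d. monom_value m' x * A (m, m')) =
      (\<Sum>(k, l)\<in>?J. a (k, l) * (W k m * poly_value (w l) x + W l m * poly_value (w k) x))" for m x
  proof -
    have "(\<Sum>m'\<in>monoms d. monom_value m' x * A (m, m')) =
      (\<Sum>(k, l)\<in>?J. a (k, l) * (W k m * (\<Sum>m'\<in>monoms d. monom_value m' x * W l m')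
        + W l m * (\<Sum>m'\<in>monoms d. monom_value m' x * W k m')))"
      unfolding A_def case_prod_conv sum_distrib_left
      by (subst sum.swap) (simp add: sum_distrib_left sum.distrib algebra_simps case_prod_unfold)
    then show ?thesis by (simp add: wx)
  qed
  have full: "(\<Sum>m\<in>monoms d. monom_value m x * (\<Sum>m'\<in>monoms d. monom_value m' x' * A (m, m'))) =
      (\<Sum>(k, l)\<in>?J. a (k, l) * (poly_value (w k) x * poly_value (w l) x' + poly_value (w l) x * poly_value (w k) x'))" for x x'
  proof -
    have "(\<Sum>m\<in>monoms d. monom_value m x * (\<Sum>m'\<in>monoms d. monom_value m' x' * A (m, m'))) =
      (\<Sum>(k, l)\<in>?J. a (k, l) * ((\<Sum>m\<in>monoms d. monom_value m x * W k m) * poly_value (w l) x'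
        + (\<Sum>m\<in>monoms d. monom_value m x * W l m) * poly_value (w k) x'))"
      unfolding half sum_distrib_left
      by (subst sum.swap) (simp add: sum_distrib_left sum_distrib_right sum.distrib algebra_simps case_prod_unfold)
    then show ?thesis by (simp add: wx)
  qed
  have "\<forall>m\<in>monoms d. \<forall>m'\<in>monoms d. A (m, m') = 0"
  proof (rule square_injectiveD[OF inj], goal_cases)
    case (1 m m')
    show ?case by (simp add: A_def algebra_simps)
  next
    case (2 j m)
    then show ?case by (simp add: half w(2))
  next
    case (3 x)
    have "(\<Sum>(m, m')\<in>monoms d \<times> monoms d. monom_value m (($) x) * monom_value m' (($) x) * A (m, m'))
      = (\<Sum>(k, l)\<in>?J. 2 * (a (k, l) * (poly_value (w k) (($) x) * poly_value (w l) (($) x))))"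
      using full[of "($) x" "($) x"]
      by (simp add: sum_distrib_left algebra_simps flip: sum.cartesian_product)
    also have "\<dots> = 2 * poly_value (\<Sum>(k, l)\<in>?J. a (k, l) *\<^sub>R (w k * w l)) (($) x)"
      by (simp add: sum_distrib_left poly_value_sum poly_value_scaleR poly_value_mult case_prod_unfold)
    finally show ?case by (simp only: assms(5)) simp
  qed
  then have zero: "(\<Sum>(k, l)\<in>?J. a (k, l) * (poly_value (w k) x * poly_value (w l) x' + poly_value (w l) x * poly_value (w k) x')) = 0" for x x'
    by (simp flip: full)
  show ?thesis
  proof safe
    fix k l :: nat assume kl: "k \<le> l" "l \<le> d"
    \<comment> \<open>At the arguments \<open>y k\<close> and \<open>y l\<close> only the index
      \<open>(k, l)\<close> survives; for \<open>k = l\<close> both halves of the symmetrization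
      contribute, whence the factor 2.\<close>
    have "(\<Sum>i\<in>?J. if i = (k, l) then (if k = l then 2 else 1) * a (k, l) else 0) =
      (\<Sum>(k', l')\<in>?J. a (k', l') * (poly_value (w k') (($) (y k)) * poly_value (w l') (($) (y l)) +
        poly_value (w l') (($) (y k)) * poly_value (w k') (($) (y l))))"
    proof (intro sum.cong refl, clarify)
      fix k' l' assume "k' \<le> l'" "l' \<le> d"
      moreover from this kl have "k' \<le> d" "k \<le> d" by simp_all
      ultimately show "(if (k', l') = (k, l) then (if k = l then 2 else 1) * a (k, l) else 0) =
          a (k', l') * (poly_value (w k') (($) (y k)) * poly_value (w l') (($) (y l)) +
            poly_value (w l') (($) (y k)) * poly_value (w k') (($) (y l)))"
        using kl by (cases "k' = k"; cases "l' = l"; cases "l' = k"; cases "k' = l") (simp_all add: w(3))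
    qed
    then have "0 = (\<Sum>i\<in>?J. if i = (k, l) then (if k = l then 2 else 1) * a (k, l) else 0)"
      by (simp only: zero)
    also have "\<dots> = (if k = l then 2 else 1) * a (k, l)"
      using kl finJ by simp
    finally show "a (k, l) = 0" by (auto split: if_splits)
  qed
qed

text \<open>Independence of the products allows the Gram matrix to be read off from the polynomial
  alone, whatever the representation as a sum of squares, by functionals dual to the
  products.\<close>

lemma gram_functionals:
  fixes w :: "nat \<Rightarrow> 'n::finite rpoly"
  assumes ind: "\<And>a. (\<Sum>(k, l)\<in>{(k, l). k \<le> l \<and> l \<le> d}. a (k, l) *\<^sub>R (w k * w l)) = 0 \<Longrightarrow>
      \<forall>i\<in>{(k, l). k \<le> l \<and> l \<le> d}. a i = 0"
  obtains \<phi> :: "nat \<Rightarrow> nat \<Rightarrow> 'n rpoly \<Rightarrow> real" where "\<And>k l. k \<le> d \<Longrightarrow> l \<le> d \<Longrightarrow> linear (\<phi> k l)"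
    "\<And>k l b (r::nat). k \<le> d \<Longrightarrow> l \<le> d \<Longrightarrow>
       \<phi> k l (\<Sum>i<r. (\<Sum>j<Suc d. b i j *\<^sub>R w j)\<^sup>2) = (\<Sum>i<r. b i k * b i l)"
proof -
  let ?J = "{(k, l). k \<le> l \<and> l \<le> d}"
  have finJ: "finite ?J" by (rule finite_subset[of _ "{..d} \<times> {..d}"]) auto
  have "\<exists>\<psi> :: nat \<times> nat \<Rightarrow> 'n rpoly \<Rightarrow> real. \<forall>i\<in>?J. linear (\<psi> i) \<and>
      (\<forall>j\<in>?J. \<psi> i (case j of (k, l) \<Rightarrow> w k * w l) = (if i = j then 1 else 0))"
  proof (rule dual_functionals[OF finJ])
    fix a assume "(\<Sum>j\<in>?J. a j *\<^sub>R (case j of (k, l) \<Rightarrow> w k * w l)) = 0"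
    then show "\<forall>i\<in>?J. a i = 0" by (intro ind) (simp add: case_prod_unfold)
  qed
  then obtain \<psi> :: "nat \<times> nat \<Rightarrow> 'n rpoly \<Rightarrow> real" where \<psi>0: "\<forall>i\<in>?J. linear (\<psi> i) \<and>
      (\<forall>j\<in>?J. \<psi> i (case j of (k, l) \<Rightarrow> w k * w l) = (if i = j then 1 else 0))"
    by (rule exE)
  have lin: "linear (\<psi> (k, l))" if "k \<le> l" "l \<le> d" for k l
    using bspec[OF \<psi>0, of "(k, l)"] that by simp
  have \<psi>: "\<psi> i (w k * w l) = (if i = (k, l) then 1 else 0)" if "i \<in> ?J" "k \<le> l" "l \<le> d" for i k l
    using bspec[OF conjunct2[OF bspec[OF \<psi>0 that(1)]], of "(k, l)"] that(2,3) by simp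
  \<comment> \<open>In a square, \<open>w k * w l\<close> with \<open>k < l\<close> occurs twice, so
    the off-diagonal coefficient is halved.\<close>
  define \<phi> where "\<phi> = (\<lambda>k l p. (if k = l then 1 else 1 / 2) * \<psi> (min k l, max k l) p)"
  have lin\<phi>: "linear (\<phi> k l)" if "k \<le> d" "l \<le> d" for k l
  proof -
    have "linear (\<psi> (min k l, max k l))" using that by (intro lin) auto
    then show ?thesis
      unfolding \<phi>_def by (intro linearI) (simp_all add: linear_add linear_scale distrib_left)
  qed
  have \<phi>w: "\<phi> k l (w i * w j) = ((if i = k \<and> j = l then 1 else 0) + (if i = l \<and> j = k then 1 else 0)) / 2"
    if "k \<le> d" "l \<le> d" "i \<le> d" "j \<le> d" for k l i j
  proof -
    have "\<psi> (min k l, max k l) (w i * w j) = \<psi> (min k l, max k l) (w (min i j) * w (max i j))"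
      by (simp add: min_def max_def mult.commute)
    also have "\<dots> = (if (min k l, max k l) = (min i j, max i j) then 1 else 0)"
      by (intro \<psi>) (use that in auto)
    finally have "\<phi> k l (w i * w j) =
        (if k = l then 1 else 1 / 2) * (if (min k l, max k l) = (min i j, max i j) then 1 else 0)"
      by (simp add: \<phi>_def)
    moreover have "(min k l, max k l) = (min i j, max i j) \<longleftrightarrow> i = k \<and> j = l \<or> i = l \<and> j = k"
      by (cases "k \<le> l"; cases "i \<le> j") (auto simp: min_def max_def)
    ultimately have "\<phi> k l (w i * w j) =
        (if k = l then 1 else 1 / 2) * (if i = k \<and> j = l \<or> i = l \<and> j = k then 1 else 0)"
      by (simp only:)
    then show ?thesis by (cases "k = l"; cases "i = k"; cases "j = l"; simp)
  qed
  show ?thesis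
  proof (rule that[of \<phi>])
    show "linear (\<phi> k l)" if "k \<le> d" "l \<le> d" for k l by (rule lin\<phi>[OF that])
  next
    fix k l r :: nat and b :: "nat \<Rightarrow> nat \<Rightarrow> real" assume kl: "k \<le> d" "l \<le> d"
    have sum_delta: "(\<Sum>i<Suc d. f i * (if i = k then 1 else 0)) = f k" if "k \<le> d" for k and f :: "nat \<Rightarrow> real"
      using that by (simp add: if_distrib[of "\<lambda>t. _ * t"] del: sum.lessThan_Suc cong: if_cong)
    have "\<phi> k l ((\<Sum>j<Suc d. c j *\<^sub>R w j)\<^sup>2) = c k * c l" for c
    proof -
      have "\<phi> k l ((\<Sum>j<Suc d. c j *\<^sub>R w j)\<^sup>2) = (\<Sum>i<Suc d. \<Sum>j<Suc d. c i * c j * \<phi> k l (w i * w j))"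
        by (simp add: power2_eq_square sum_product scaleR_mult_poly linear_sum[OF lin\<phi>[OF kl]]
            linear_scale[OF lin\<phi>[OF kl]] mult_ac del: sum.lessThan_Suc)
      also have "\<dots> = (\<Sum>i<Suc d. \<Sum>j<Suc d. (c i * (if i = k then 1 else 0)) * (c j * (if j = l then 1 else 0)) / 2 +
          (c i * (if i = l then 1 else 0)) * (c j * (if j = k then 1 else 0)) / 2)"
        proof (intro sum.cong refl)
        fix i j assume "i \<in> {..<Suc d}" "j \<in> {..<Suc d}"
        then have ij: "i \<le> d" "j \<le> d" by auto
        show "c i * c j * \<phi> k l (w i * w j) =
          (c i * (if i = k then 1 else 0)) * (c j * (if j = l then 1 else 0)) / 2 +
          (c i * (if i = l then 1 else 0)) * (c j * (if j = k then 1 else 0)) / 2"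
          unfolding \<phi>w[OF kl ij] by (cases "i = k"; cases "j = l"; cases "i = l"; cases "j = k"; simp)
      qed
      also have "\<dots> = c k * c l"
        unfolding sum.distrib sum_divide_distrib[symmetric] sum_product[symmetric]
        by (simp only: sum_delta kl) simp
      finally show ?thesis .
    qed
    then show "\<phi> k l (\<Sum>i<r. (\<Sum>j<Suc d. b i j *\<^sub>R w j)\<^sup>2) = (\<Sum>i<r. b i k * b i l)"
      by (simp add: linear_sum[OF lin\<phi>[OF kl]] del: sum.lessThan_Suc)
  qed
qed

section \<open>Polynomial functions of the coefficients and the exceptional set\<close>

definition polynomial_map :: "(('v \<Rightarrow> real) \<Rightarrow> real) \<Rightarrow> bool" where
  "polynomial_map F \<longleftrightarrow> (\<exists>q. \<forall>x. poly_value q x = F x)"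

lemma polynomial_map_const: "polynomial_map (\<lambda>_. a)"
  unfolding polynomial_map_def
  by (rule exI[of _ "Poly_Mapping.single 0 a"]) (simp add: poly_value_single)

lemma polynomial_map_coordinate: "polynomial_map (\<lambda>x. x v)"
  unfolding polynomial_map_def
  by (rule exI[of _ "Poly_Mapping.single (Poly_Mapping.single v 1) 1"]) (simp add: poly_value_single)

lemma polynomial_map_mult:
  "polynomial_map F \<Longrightarrow> polynomial_map G \<Longrightarrow> polynomial_map (\<lambda>x. F x * G x)"
  unfolding polynomial_map_def by (metis poly_value_mult)

lemma polynomial_map_diff:
  "polynomial_map F \<Longrightarrow> polynomial_map G \<Longrightarrow> polynomial_map (\<lambda>x. F x - G x)"
  unfolding polynomial_map_def by (metis poly_value_diff)

lemma polynomial_map_sum: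
  assumes "\<And>i. i \<in> I \<Longrightarrow> polynomial_map (F i)"
  shows "polynomial_map (\<lambda>x. \<Sum>i\<in>I. F i x)"
proof -
  from assms obtain q where "\<And>i x. i \<in> I \<Longrightarrow> poly_value (q i) x = F i x"
    unfolding polynomial_map_def by metis
  then show ?thesis
    unfolding polynomial_map_def by (intro exI[of _ "\<Sum>i\<in>I. q i"]) (simp add: poly_value_sum)
qed

text \<open>The exceptional set is the zero locus of the pivot product \<open>D\<close> obtained by
  eliminating in the Gram matrix. Where \<open>D\<close> is nonzero the Gram matrix has trivial
  kernel, which rules out fewer than \<open>d + 1\<close> squares; the upper bound is
  \<open>combination_of_squares\<close>. The vectors \<open>v\<close> represent \<open>Z\<close>
  through the last hypothesis.\<close>

lemma general_sos_length:
  fixes v y :: "nat \<Rightarrow> real ^ 'n::finite" and Z :: "(real ^ 'n) set set"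
  assumes uni: "unisolvent d s v y"
    and card: "card (monoms d :: ('n \<Rightarrow>\<^sub>0 nat) set) = s + (d + 1)"
    and inj: "square_injective d s v"
    and Z: "\<And>f e. f \<in> forms e \<Longrightarrow>
      (\<forall>L\<in>Z. vanishes_at f L) \<longleftrightarrow> (\<forall>j<s. poly_value f (($) (v j)) = 0)"
  obtains A f\<^sub>0 where "algebraic_subset (span (sos_vanishing d Z)) A"
    "f\<^sub>0 \<in> sos_vanishing d Z - A" "\<forall>f \<in> sos_vanishing d Z - A. sos_length d f = d + 1"
proof -
  obtain w where w: "\<And>k. w k \<in> forms d" "\<And>k j. j < s \<Longrightarrow> poly_value (w k) (($) (v j)) = 0"
    "\<And>k l. k \<le> d \<Longrightarrow> l \<le> d \<Longrightarrow> poly_value (w k) (($) (y l)) = (if k = l then 1 else 0)"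
    and expand: "\<And>p. p \<in> forms d \<Longrightarrow> (\<And>j. j < s \<Longrightarrow> poly_value p (($) (v j)) = 0) \<Longrightarrow>
       p = (\<Sum>k<Suc d. poly_value p (($) (y k)) *\<^sub>R w k)"
    using unisolvent_dual_forms[OF uni card] by blast
  obtain \<phi> :: "nat \<Rightarrow> nat \<Rightarrow> 'n rpoly \<Rightarrow> real"
    where lin: "\<And>k l. k \<le> d \<Longrightarrow> l \<le> d \<Longrightarrow> linear (\<phi> k l)"
    and \<phi>: "\<And>k l b (r::nat). k \<le> d \<Longrightarrow> l \<le> d \<Longrightarrow>
       \<phi> k l (\<Sum>i<r. (\<Sum>j<Suc d. b i j *\<^sub>R w j)\<^sup>2) = (\<Sum>i<r. b i k * b i l)"
    using gram_functionals[OF products_independent[OF inj w]] by blast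
  \<comment> \<open>Algebraic subsets are cut out by polynomials in the coefficients, so the Gram
    entries are rewritten as such; the monomials of degree \<open>2 * d\<close> suffice on forms of
    that degree.\<close>
  define G where "G = (\<lambda>k l x. \<Sum>m\<in>monoms (2 * d). x m * \<phi> k l (Poly_Mapping.single m 1))"
  have G: "G k l (Poly_Mapping.lookup f) = \<phi> k l f" if "k \<le> d" "l \<le> d" "f \<in> forms (2 * d)" for k l f
    using arg_cong[OF forms_expand[OF that(3)], of "\<phi> k l"] lin[OF that(1,2)]
    by (simp add: G_def linear_sum linear_scale)
  have coeffs: "p i = (\<Sum>k<Suc d. poly_value (p i) (($) (y k)) *\<^sub>R w k)"
    if "f \<in> sos_vanishing d Z" "\<And>i. i < r \<Longrightarrow> p i \<in> forms d" "f = (\<Sum>i<r. (p i)\<^sup>2)" "i < r"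
    for f and r i :: nat and p
  proof (rule expand)
    fix j assume "j < s"
    then have "poly_value f (($) (v j)) = 0"
      using that(1) Z[of f "2 * d"] by (simp add: sos_vanishing_def sos_cone_def)
    then show "poly_value (p i) (($) (v j)) = 0"
      using poly_value_square_sum_eq_0 that(3,4) by blast
  qed (use that in simp)
  \<comment> \<open>The Gram matrix of \<open>f\<^sub>0\<close> is the identity, so
    \<open>f\<^sub>0\<close> lies outside the exceptional set.\<close>
  define f\<^sub>0 where "f\<^sub>0 = (\<Sum>i<Suc d. (w i)\<^sup>2)"
  have sq: "sum_of_squares d (Suc d) f\<^sub>0"
    unfolding sum_of_squares_def f\<^sub>0_def by (intro exI[of _ w]) (simp add: w(1))
  have f\<^sub>0_forms: "f\<^sub>0 \<in> forms (2 * d)"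
    unfolding f\<^sub>0_def by (intro subspace_sum subspace_forms forms_power2 w)
  have f\<^sub>0: "f\<^sub>0 \<in> sos_vanishing d Z"
    using sq f\<^sub>0_forms Z[OF f\<^sub>0_forms] w(2)
    by (auto simp: sos_vanishing_def sos_cone_def f\<^sub>0_def poly_value_sum poly_value_power poly_value_add)
  have gram\<^sub>0: "\<phi> k l f\<^sub>0 = (if k = l then 1 else 0)" if "k \<le> d" "l \<le> d" for k l
  proof -
    have delta: "(\<Sum>j<Suc d. (if i = j then 1 else 0) *\<^sub>R w j) = w i" if "i < Suc d" for i
    proof -
      have "(\<Sum>j<Suc d. (if i = j then 1 else 0) *\<^sub>R w j) = (\<Sum>j<Suc d. if i = j then w j else 0)"
        by (intro sum.cong) auto
      also have "\<dots> = w i" using that by (subst sum.delta') auto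
      finally show ?thesis .
    qed
    have "f\<^sub>0 = (\<Sum>i<Suc d. (\<Sum>j<Suc d. (if i = j then 1 else 0) *\<^sub>R w j)\<^sup>2)"
      unfolding f\<^sub>0_def by (intro sum.cong refl) (simp only: delta lessThan_iff)
    then have "\<phi> k l f\<^sub>0 = (\<Sum>i<Suc d. (if i = k then 1 else 0) * (if i = l then 1 else 0))"
      by (simp only: \<phi>[OF that])
    also have "\<dots> = (\<Sum>i<Suc d. if i = k then (if k = l then 1 else 0) else 0)"
      by (intro sum.cong) auto
    also have "\<dots> = (if k = l then 1 else 0)"
      using that by (subst sum.delta) auto
    finally show ?thesis .
  qed
  have "\<exists>e D. (\<lambda>_::unit. polynomial_map) e D \<and> D (Poly_Mapping.lookup f\<^sub>0) \<noteq> 0 \<and>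
    (\<forall>g x. D g \<noteq> 0 \<longrightarrow> (\<forall>i\<in>{..d}. (\<Sum>j\<in>{..d}. G i j g * x j) = 0) \<longrightarrow> (\<forall>j\<in>{..d}. x j = 0))"
  \<comment> \<open>Here degrees are irrelevant, so they are taken from the one-element
    type.\<close>
  proof (rule elimination_nonsingular[where z = "()" and pl = "\<lambda>_ _. ()" and \<delta> = "\<lambda>_. ()"])
    show "polynomial_map (G i j)" for i j
      unfolding G_def
      by (intro polynomial_map_sum polynomial_map_mult polynomial_map_coordinate polynomial_map_const)
  next
    fix x assume x: "\<And>i. i \<in> {..d} \<Longrightarrow> (\<Sum>j\<le>d. G i j (Poly_Mapping.lookup f\<^sub>0) * x j) = 0"
    have "x i = 0" if "i \<le> d" for i
    proof -
      have "(\<Sum>j\<le>d. G i j (Poly_Mapping.lookup f\<^sub>0) * x j) = (\<Sum>j\<le>d. if j = i then x i else 0)"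
        using that by (intro sum.cong) (auto simp: G f\<^sub>0_forms gram\<^sub>0)
      also have "\<dots> = x i" using that by (subst sum.delta) auto
      finally show ?thesis using x[of i] that by simp
    qed
    then show "\<forall>j\<in>{..d}. x j = 0" by simp
  qed (auto intro: polynomial_map_const polynomial_map_mult polynomial_map_diff)
  then obtain D where D: "polynomial_map D" "D (Poly_Mapping.lookup f\<^sub>0) \<noteq> 0"
    "\<And>g x. D g \<noteq> 0 \<Longrightarrow> (\<And>i. i \<le> d \<Longrightarrow> (\<Sum>j\<le>d. G i j g * x j) = 0) \<Longrightarrow> (\<forall>j\<le>d. x j = 0)"
    by (metis atMost_iff)
  obtain Q where Q: "\<And>g. poly_value Q g = D g" using D(1) by (auto simp: polynomial_map_def)
  define A where "A = {f \<in> span (sos_vanishing d Z). \<forall>q\<in>{Q}. poly_value q (Poly_Mapping.lookup f) = 0}"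
  show ?thesis
  proof (rule that)
    show "algebraic_subset (span (sos_vanishing d Z)) A"
      unfolding algebraic_subset_def A_def by (rule exI, rule refl)
    show "f\<^sub>0 \<in> sos_vanishing d Z - A" using f\<^sub>0 D(2) by (simp add: A_def Q)
    show "\<forall>f \<in> sos_vanishing d Z - A. sos_length d f = d + 1"
    proof
      fix f assume f: "f \<in> sos_vanishing d Z - A"
      then have fin: "f \<in> sos_vanishing d Z" and Df: "D (Poly_Mapping.lookup f) \<noteq> 0"
        by (auto simp: A_def Q span_base)
      have f_forms: "f \<in> forms (2 * d)" using fin by (simp add: sos_vanishing_def sos_cone_def)
      show "sos_length d f = d + 1"
        unfolding sos_length_def
      proof (rule Least_equality)
        obtain r :: nat and p where p: "\<And>i. i < r \<Longrightarrow> p i \<in> forms d" "f = (\<Sum>i<r. (p i)\<^sup>2)"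
          using fin unfolding sos_vanishing_def sos_cone_def sum_of_squares_def by blast
        have "\<exists>q. (\<forall>k<Suc d. q k \<in> span (w ` {..<Suc d})) \<and> (\<Sum>i<r. (p i)\<^sup>2) = (\<Sum>k<Suc d. (q k)\<^sup>2)"
          by (rule combination_of_squares) (rule coeffs[OF fin p])
        then obtain q where q: "\<forall>k<Suc d. q k \<in> span (w ` {..<Suc d})" "f = (\<Sum>k<Suc d. (q k)\<^sup>2)"
          unfolding p(2) by (elim exE conjE)
        have "span (w ` {..<Suc d}) \<subseteq> forms d"
          by (intro span_minimal subspace_forms) (use w in auto)
        with q show "sum_of_squares d (d + 1) f"
          unfolding sum_of_squares_def by (intro exI[of _ q]) auto
      next
        fix r assume "sum_of_squares d r f"
        then obtain p where p: "\<And>i. i < r \<Longrightarrow> p i \<in> forms d" "f = (\<Sum>i<r. (p i)\<^sup>2)"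
          unfolding sum_of_squares_def by blast
        show "d + 1 \<le> r"
        proof (rule ccontr)
          assume "\<not> d + 1 \<le> r"
          define b where "b = (\<lambda>i k. poly_value (p i) (($) (y k)))"
          have fb: "f = (\<Sum>i<r. (\<Sum>j<Suc d. b i j *\<^sub>R w j)\<^sup>2)"
            unfolding p(2) using coeffs[OF fin p] by (intro sum.cong) (simp_all add: b_def)
          have gram: "G k l (Poly_Mapping.lookup f) = (\<Sum>i<r. b i k * b i l)" if "k \<le> d" "l \<le> d" for k l
          proof -
            have "\<phi> k l f = (\<Sum>i<r. b i k * b i l)" by (subst fb) (rule \<phi>[OF that])
            then show ?thesis by (simp only: G[OF that f_forms])
          qed
          \<comment> \<open>With \<open>r \<le> d\<close> squares the coefficient matrix
            \<open>b\<close> has fewer rows than columns. A kernel vector of \<open>b\<close> is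
            also one of the Gram matrix, the product of the transpose of \<open>b\<close> with
            \<open>b\<close>.\<close>
          have "\<exists>x. (\<exists>j\<in>{..d}. x j \<noteq> 0) \<and> (\<forall>i\<in>{..<r}. (\<Sum>j\<in>{..d}. b i j * x j) = 0)"
            using \<open>\<not> d + 1 \<le> r\<close> by (intro underdetermined_system) auto
          then obtain x where x: "\<exists>j\<le>d. x j \<noteq> 0" "\<And>i. i < r \<Longrightarrow> (\<Sum>j\<le>d. b i j * x j) = 0"
            by auto
          have "(\<Sum>l\<le>d. G k l (Poly_Mapping.lookup f) * x l) = 0" if "k \<le> d" for k
          proof -
            have "(\<Sum>l\<le>d. G k l (Poly_Mapping.lookup f) * x l) = (\<Sum>l\<le>d. \<Sum>i<r. b i k * (b i l * x l))"
              by (intro sum.cong refl) (simp add: gram that sum_distrib_right mult.assoc)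
            also have "\<dots> = (\<Sum>i<r. b i k * (\<Sum>l\<le>d. b i l * x l))"
              by (subst sum.swap) (simp add: sum_distrib_left)
            also have "\<dots> = 0" using x(2) by simp
            finally show ?thesis .
          qed
          with D(3)[OF Df] x(1) show False by auto
        qed
      qed
    qed
  qed
qed

section \<open>The star configuration\<close>

definition lagrange :: "nat \<Rightarrow> nat \<Rightarrow> real poly" where
  "lagrange d k = (\<Prod>j\<in>{..d} - {k}. smult (1 / (real k - real j)) [:- real j, 1:])"

lemma poly_lagrange_node:
  assumes "i \<le> d" "k \<le> d"
  shows "poly (lagrange d k) (real i) = (if i = k then 1 else 0)"
proof (cases "i = k")
  case True
  then show ?thesis by (auto simp: lagrange_def poly_prod simp flip: diff_divide_distrib intro!: prod.neutral)
next
  case False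
  then have "\<exists>j\<in>{..d} - {k}. poly (smult (1 / (real k - real j)) [:- real j, 1:]) (real i) = 0"
    using assms by (intro bexI[of _ i]) auto
  then show ?thesis using False by (simp add: lagrange_def poly_prod)
qed

lemma degree_lagrange: "k \<le> d \<Longrightarrow> degree (lagrange d k) \<le> d"
  unfolding lagrange_def
  by (rule order.trans[OF degree_prod_sum_le]) (auto intro!: order.trans[OF sum_bounded_above[of _ _ 1]])

text \<open>Every node other than \<open>k\<close> is a simple root of
  \<open>lagrange d k\<close>.\<close>

lemma pderiv_lagrange_node_nonzero:
  assumes "i \<le> d" "k \<le> d" "i \<noteq> k"
  shows "poly (pderiv (lagrange d k)) (real i) \<noteq> 0"
proof -
  let ?f = "\<lambda>j. smult (1 / (real k - real j)) [:- real j, 1:]"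
  define G where "G = (\<Prod>j\<in>{..d} - {k} - {i}. ?f j)"
  have "lagrange d k = ?f i * G"
    unfolding lagrange_def G_def by (rule prod.remove) (use assms in auto)
  also have "\<dots> = smult (1 / (real k - real i)) ([:- real i, 1:] * G)"
    by (rule mult_smult_left)
  finally have "poly (pderiv (lagrange d k)) (real i) = 1 / (real k - real i) * poly G (real i)"
    by (simp only: pderiv_smult pderiv_mult poly_smult poly_add poly_mult) (simp add: pderiv_pCons)
  moreover have "poly G (real i) \<noteq> 0"
    using assms by (auto simp: G_def poly_prod)
  ultimately show ?thesis using assms by auto
qed

lemma poly_eq_0_nodes:
  fixes p :: "real poly"
  assumes "degree p \<le> d" "\<And>i. i \<le> d \<Longrightarrow> poly p (real i) = 0"
  shows "p = 0"
proof (rule ccontr)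
  assume "p \<noteq> 0"
  then have fin: "finite {x. poly p x = 0}" by (rule poly_roots_finite)
  have "Suc d = card (real ` {..d})" by (simp add: card_image)
  also have "\<dots> \<le> card {x. poly p x = 0}"
    using assms(2) by (intro card_mono[OF fin]) auto
  also have "\<dots> \<le> degree p" using \<open>p \<noteq> 0\<close> by (rule card_poly_roots_bound)
  finally show False using assms(1) by simp
qed

lemma lagrange_interpolation:
  fixes p :: "real poly"
  assumes "degree p \<le> d"
  shows "poly p a = (\<Sum>k\<le>d. poly p (real k) * poly (lagrange d k) a)"
proof -
  let ?q = "p - (\<Sum>k\<le>d. smult (poly p (real k)) (lagrange d k))"
  have "?q = 0"
  proof (rule poly_eq_0_nodes)
    show "degree ?q \<le> d"
      using assms degree_lagrange
      by (intro degree_diff_le degree_sum_le) (auto intro: order.trans[OF degree_smult_le])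
  next
    fix i assume "i \<le> d"
    have "(\<Sum>k\<le>d. poly p (real k) * poly (lagrange d k) (real i)) = (\<Sum>k\<le>d. if k = i then poly p (real i) else 0)"
      using \<open>i \<le> d\<close> by (intro sum.cong) (auto simp: poly_lagrange_node)
    also have "\<dots> = poly p (real i)" using \<open>i \<le> d\<close> by (subst sum.delta) auto
    finally show "poly ?q (real i) = 0" by (simp add: poly_sum)
  qed
  from arg_cong[OF this, of "\<lambda>q. poly q a"] show ?thesis by (simp add: poly_sum)
qed

text \<open>
  The line \<open>x\<^sub>1 + t x\<^sub>2 + t\<^sup>2 x\<^sub>3 = 0\<close> meets the line with parameter \<open>t'\<close> in \<open>sympoint t t'\<close>, so the
  points \<open>sympoint i j\<close> with \<open>i < j \<le> d\<close> form a star configuration. Forms of degree \<open>d\<close> pull back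
  along \<open>sympoint\<close> to symmetric polynomials of degree at most \<open>d\<close> in each variable.
\<close>

definition sympoint :: "real \<Rightarrow> real \<Rightarrow> real ^ 3" where
  "sympoint a b = vector [a * b, - (a + b), 1]"

lemma sympoint_commute: "sympoint a b = sympoint b a"
  by (simp add: sympoint_def mult.commute add.commute)

lemma monoms_3: "m \<in> monoms d \<longleftrightarrow>
    Poly_Mapping.lookup m (1::3) + Poly_Mapping.lookup m 2 + Poly_Mapping.lookup m 3 = d"
  by (simp add: monoms_def sum_3)

lemma monom_value_sympoint:
  "monom_value m (($) (sympoint a b)) = (a * b) ^ Poly_Mapping.lookup m 1 * (- (a + b)) ^ Poly_Mapping.lookup m 2"
proof -
  have "monom_value m (($) (sympoint a b)) =
      (\<Prod>i\<in>{1, 2, 3}. sympoint a b $ i ^ Poly_Mapping.lookup m i)"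
    by (rule monom_value_superset) (use UNIV_3 in auto)
  then show ?thesis by (simp add: sympoint_def)
qed

text \<open>The argument is a coefficient function instead of a form, so that the rows of a tensor
  can be pulled back one slot at a time.\<close>

definition pullback :: "nat \<Rightarrow> ((3 \<Rightarrow>\<^sub>0 nat) \<Rightarrow> real) \<Rightarrow> real \<Rightarrow> real \<Rightarrow> real" where
  "pullback d c a b = (\<Sum>m\<in>monoms d. monom_value m (($) (sympoint a b)) * c m)"

lemma pullback_commute: "pullback d c a b = pullback d c b a"
  by (simp add: pullback_def sympoint_commute[of a b])

text \<open>For fixed \<open>b\<close> the first two coordinates of \<open>sympoint a b\<close> have
  degree at most 1 in \<open>a\<close> and the third is 1, so the pullback has degree at most
  \<open>d\<close> in \<open>a\<close> and is determined by its values at the \<open>d + 1\<close>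
  nodes.\<close>

lemma pullback_interpolation:
  "pullback d c a b = (\<Sum>k\<le>d. pullback d c (real k) b * poly (lagrange d k) a)"
proof -
  define P where "P = (\<Sum>m\<in>monoms d. smult (c m)
    ([:0, b:] ^ Poly_Mapping.lookup m 1 * [:- b, - 1:] ^ Poly_Mapping.lookup m (2::3)))"
  have P: "pullback d c a b = poly P a" for a
  proof -
    have "- (a + b) = - b - a" by simp
    then show ?thesis
      by (simp only: pullback_def P_def poly_sum monom_value_sympoint) (simp add: mult_ac)
  qed
  have "degree P \<le> d"
    unfolding P_def
  proof (rule degree_sum_le)
    fix m :: "3 \<Rightarrow>\<^sub>0 nat" assume "m \<in> monoms d"
    have pow: "degree (q ^ n) \<le> n" if "degree q \<le> 1" for q :: "real poly" and n
      using degree_power_le[of q n] mult_le_mono1[OF that, of n] by linarith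
    have "degree (smult (c m) ([:0, b:] ^ Poly_Mapping.lookup m 1 * [:- b, - 1:] ^ Poly_Mapping.lookup m 2))
      \<le> Poly_Mapping.lookup m 1 + Poly_Mapping.lookup m 2"
      by (intro order.trans[OF degree_smult_le] order.trans[OF degree_mult_le] add_mono pow) auto
    also have "\<dots> \<le> d" using \<open>m \<in> monoms d\<close> by (simp add: monoms_3)
    finally show "degree (smult (c m) ([:0, b:] ^ Poly_Mapping.lookup m 1 * [:- b, - 1:] ^ Poly_Mapping.lookup m 2)) \<le> d" .
  qed simp
  then show ?thesis unfolding P by (rule lagrange_interpolation)
qed

text \<open>Interpolation in both variables; vanishing at the star points kills all pairs of
  distinct nodes and leaves the diagonal ones.\<close>

lemma pullback_diagonal:
  assumes "\<And>i j. i < j \<Longrightarrow> j \<le> d \<Longrightarrow> pullback d c (real i) (real j) = 0"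
  shows "pullback d c a b = (\<Sum>k\<le>d. pullback d c (real k) (real k) * poly (lagrange d k) a * poly (lagrange d k) b)"
proof -
  have off: "pullback d c (real i) (real j) = 0" if "i \<le> d" "j \<le> d" "i \<noteq> j" for i j
    using that assms[of i j] assms[of j i] pullback_commute[of d c "real i" "real j"]
    by (cases "i < j") auto
  have "pullback d c (real k) b = pullback d c (real k) (real k) * poly (lagrange d k) b" if "k \<le> d" for k
  proof -
    have "pullback d c (real k) b = (\<Sum>j\<le>d. pullback d c (real j) (real k) * poly (lagrange d j) b)"
      by (subst pullback_commute) (rule pullback_interpolation)
    also have "\<dots> = (\<Sum>j\<le>d. if j = k then pullback d c (real k) (real k) * poly (lagrange d k) b else 0)"
      using that by (intro sum.cong) (auto simp: off)
    also have "\<dots> = pullback d c (real k) (real k) * poly (lagrange d k) b"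
      using that by (subst sum.delta) auto
    finally show ?thesis .
  qed
  then show ?thesis
    by (subst pullback_interpolation) (simp add: mult_ac)
qed

text \<open>This is the algebraic independence of \<open>a * b\<close> and \<open>a + b\<close>:
  already the real points \<open>sympoint a b\<close> determine the coefficients.\<close>

lemma pullback_eq_0:
  assumes "\<And>a b. pullback d c a b = 0" "m \<in> monoms d"
  shows "c m = 0"
proof -
  let ?i = "\<lambda>m. Poly_Mapping.lookup m (1::3)" and ?j = "\<lambda>m. Poly_Mapping.lookup m (2::3)"
  \<comment> \<open>The pullback as a polynomial in the first coordinate, with the second coordinate
    fixed to \<open>v\<close>. The points with that second coordinate are
    \<open>sympoint a (- v - a)\<close>.\<close>
  define R where "R = (\<lambda>v. \<Sum>m\<in>monoms d. monom (c m * v ^ ?j m) (?i m))"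
  have R: "R v = 0" for v
  proof (rule ccontr)
    assume "R v \<noteq> 0"
    then have "finite {u. poly (R v) u = 0}" by (rule poly_roots_finite)
    moreover have "range (\<lambda>a. a * (- v - a)) \<subseteq> {u. poly (R v) u = 0}"
    proof safe
      fix a
      have "poly (R v) (a * (- v - a)) = pullback d c a (- v - a)"
        by (simp add: R_def pullback_def poly_sum poly_monom monom_value_sympoint mult_ac)
      then show "poly (R v) (a * (- v - a)) = 0" by (simp add: assms)
    qed
    moreover have "infinite (range (\<lambda>a. a * (- v - a)))"
    proof
      assume fin: "finite (range (\<lambda>a. a * (- v - a)))"
      have "inj_on (\<lambda>a. a * (- v - a)) {\<bar>v\<bar><..}"
      proof (rule inj_onI)
        fix a b assume ab: "a \<in> {\<bar>v\<bar><..}" "b \<in> {\<bar>v\<bar><..}" "a * (- v - a) = b * (- v - b)"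
        then have "(a - b) * (a + b + v) = 0" by (simp add: algebra_simps)
        moreover have "a + b + v > 0" using ab by auto
        ultimately show "a = b" by simp
      qed
      moreover have "finite ((\<lambda>a. a * (- v - a)) ` {\<bar>v\<bar><..})"
        by (rule finite_subset[OF _ fin]) auto
      ultimately have "finite {\<bar>v\<bar><..}" by (rule finite_imageD[rotated])
      then show False by (simp add: infinite_Ioi)
    qed
    ultimately show False by (meson finite_subset)
  qed
  \<comment> \<open>One coefficient of \<open>R v\<close>, now regarded as a polynomial in
    \<open>v\<close>.\<close>
  define S where "S = (\<Sum>m'\<in>monoms d. if ?i m' = ?i m then monom (c m') (?j m') else 0)"
  have "poly S v = coeff (R v) (?i m)" for v
    by (simp add: S_def R_def poly_sum coeff_sum if_distrib[of "\<lambda>p. poly p v"] poly_monom cong: if_cong)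
  then have "S = 0" using R by (simp add: poly_all_0_iff_0[symmetric])
  have "c m = (\<Sum>m'\<in>monoms d. if m' = m then c m' else 0)"
    using assms(2) by simp
  also have "\<dots> = coeff S (?j m)"
    unfolding S_def coeff_sum
  proof (intro sum.cong refl)
    fix m' :: "3 \<Rightarrow>\<^sub>0 nat" assume m': "m' \<in> monoms d"
    have "m' = m" if "?i m' = ?i m" "?j m' = ?j m"
    proof (rule poly_mapping_eqI)
      fix k
      have "Poly_Mapping.lookup m' 3 = Poly_Mapping.lookup m 3"
        using m' assms(2) that by (simp add: monoms_3)
      then show "Poly_Mapping.lookup m' k = Poly_Mapping.lookup m k"
        using that exhaust_3[of k] by auto
    qed
    then show "(if m' = m then c m' else 0) = coeff (if ?i m' = ?i m then monom (c m') (?j m') else 0) (?j m)"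
      by auto
  qed
  finally show ?thesis using \<open>S = 0\<close> by simp
qed

section \<open>Independence of products of Lagrange polynomials\<close>

lemma sum_sum_delta: 
    fixes f :: "nat \<Rightarrow> nat \<Rightarrow> real"
    assumes "p \<le> d" "q \<le> d" 
  shows "(\<Sum>k\<le>d. \<Sum>l\<le>d. f k l * (if k = p \<and> l = q then 1 else 0)) = f p q"
proof -
  have "(\<Sum>l\<le>d. f k l * (if k = p \<and> l = q then 1 else 0)) = (if k = p then f p q else 0)" for k
  proof -
    have "(\<Sum>l\<le>d. f k l * (if k = p \<and> l = q then 1 else 0)) = (\<Sum>l\<le>d. if l = q then (if k = p then f p q else 0) else 0)"
      by (rule sum.cong) auto
    then show ?thesis using assms by simp
  qed
  then show ?thesis using assms by simp
qed

text \<open>Evaluation at \<open>a = b = k\<close> isolates \<open>\<beta> k k\<close>. The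
  derivative of the product of the polynomials of \<open>p\<close> and \<open>q\<close> vanishes at
  a node outside \<open>{p, q}\<close>; taking it at \<open>k\<close> in one variable and at
  \<open>l\<close> in the other therefore isolates the pair \<open>{k, l}\<close>.\<close>

lemma lagrange_products_independent:
  assumes sym: "\<And>k l. k \<le> d \<Longrightarrow> l \<le> d \<Longrightarrow> \<beta> k l = \<beta> l k"
    and zero: "\<And>a b. (\<Sum>k\<le>d. \<Sum>l\<le>d. \<beta> k l * (poly (lagrange d k) a * poly (lagrange d l) a) *
        (poly (lagrange d k) b * poly (lagrange d l) b)) = 0"
    and "k \<le> d" "l \<le> d"
  shows "\<beta> k l = 0"
proof -
  let ?L = "lagrange d"
  have diag: "\<beta> k k = 0" if "k \<le> d" for k
  proof -
    have "0 = (\<Sum>k'\<le>d. \<Sum>l'\<le>d. \<beta> k' l' * (poly (?L k') k * poly (?L l') k) * (poly (?L k') k * poly (?L l') k))"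
      by (rule zero[symmetric])
    also have "\<dots> = (\<Sum>k'\<le>d. \<Sum>l'\<le>d. \<beta> k' l' * (if k' = k \<and> l' = k then 1 else 0))"
      using that by (intro sum.cong refl) (auto simp: poly_lagrange_node)
    finally show ?thesis by (simp only: sum_sum_delta[OF that that])
  qed
  show ?thesis
  proof (cases "k = l")
    case False
    define \<Delta> where "\<Delta> = (\<lambda>k l x. poly (pderiv (?L k * ?L l)) x)"
    \<comment> \<open>An identity in one variable may be differentiated; this is applied first in
      \<open>a\<close> and then in \<open>b\<close>.\<close>
    have step: "(\<Sum>k\<le>d. \<Sum>l\<le>d. h k l * \<Delta> k l x) = 0"
      if "\<And>a. (\<Sum>k\<le>d. \<Sum>l\<le>d. h k l * (poly (?L k) a * poly (?L l) a)) = 0" for h x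
    proof -
      define P where "P = (\<Sum>k\<le>d. \<Sum>l\<le>d. smult (h k l) (?L k * ?L l))"
      have "poly P a = 0" for a using that[of a] by (simp add: P_def poly_sum)
      then have "P = 0" by (simp add: poly_all_0_iff_0[symmetric])
      then have "poly (pderiv P) x = 0" by simp
      then show ?thesis
        by (simp only: P_def \<Delta>_def higher_pderiv_sum[where n = "Suc 0", simplified] pderiv_smult poly_sum poly_smult)
    qed
    have 1: "(\<Sum>k\<le>d. \<Sum>l\<le>d. (\<beta> k l * (poly (?L k) b * poly (?L l) b)) * \<Delta> k l x) = 0" for b x
    proof (rule step)
      show "(\<Sum>k\<le>d. \<Sum>l\<le>d. \<beta> k l * (poly (?L k) b * poly (?L l) b) * (poly (?L k) a * poly (?L l) a)) = 0" for a
        using zero[of a b] by (simp add: mult_ac)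
    qed
    have 2: "(\<Sum>k\<le>d. \<Sum>l\<le>d. (\<beta> k l * \<Delta> k l x) * \<Delta> k l x') = 0" for x x'
    proof (rule step)
      show "(\<Sum>k\<le>d. \<Sum>l\<le>d. \<beta> k l * \<Delta> k l x * (poly (?L k) b * poly (?L l) b)) = 0" for b
        using 1[of b x] by (simp add: mult_ac)
    qed
    have \<Delta>_node: "\<Delta> p q (real i) = (if q = i then poly (pderiv (?L p)) i else 0) + (if p = i then poly (pderiv (?L q)) i else 0)"
      if "p \<le> d" "q \<le> d" "i \<le> d" for p q i
      using that by (simp add: \<Delta>_def pderiv_mult poly_lagrange_node)
    \<comment> \<open>The common factor of the two surviving terms \<open>(k, l)\<close> and
      \<open>(l, k)\<close>, nonzero because the roots involved are simple.\<close>
    let ?u = "poly (pderiv (?L l)) k * poly (pderiv (?L k)) l"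
    have "0 = (\<Sum>p\<le>d. \<Sum>q\<le>d. (\<beta> p q * \<Delta> p q k) * \<Delta> p q l)" by (rule 2[symmetric])
    also have "\<dots> = (\<Sum>p\<le>d. \<Sum>q\<le>d. (\<beta> p q * ?u) * (if p = k \<and> q = l then 1 else 0) +
        (\<beta> p q * ?u) * (if p = l \<and> q = k then 1 else 0))"
    proof (intro sum.cong refl)
      fix p q assume pq: "p \<in> {..d}" "q \<in> {..d}"
      show "\<beta> p q * \<Delta> p q k * \<Delta> p q l = (\<beta> p q * ?u) * (if p = k \<and> q = l then 1 else 0) +
          (\<beta> p q * ?u) * (if p = l \<and> q = k then 1 else 0)"
        using pq False assms(3,4) diag
        by (cases "p = k"; cases "q = l"; cases "p = l"; cases "q = k"; simp add: \<Delta>_node)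
    qed
    also have "\<dots> = \<beta> k l * ?u + \<beta> l k * ?u"
      using assms(3,4) by (simp only: sum.distrib sum_sum_delta)
    finally have "\<beta> k l * ?u = 0" unfolding sym[OF assms(3,4), symmetric] by linarith
    then show ?thesis
      using pderiv_lagrange_node_nonzero[of k d l] pderiv_lagrange_node_nonzero[of l d k] False assms(3,4)
      by simp
  qed (use diag assms(3) in simp)
qed

text \<open>The auxiliary points \<open>sympoint k k\<close> are the points where the lines touch
  the conic. They supply exactly the diagonal node values that the star points leave free.\<close>

lemma star_unisolvent:
  assumes "\<And>i j. i < j \<Longrightarrow> j \<le> d \<Longrightarrow> \<exists>n<s. v n = sympoint (real i) (real j)"
  shows "unisolvent d s v (\<lambda>k. sympoint (real k) (real k))"
  unfolding unisolvent_def
proof (intro allI impI ballI)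
  fix c and m :: "3 \<Rightarrow>\<^sub>0 nat"
  assume v: "\<forall>j<s. (\<Sum>m\<in>monoms d. monom_value m (($) (v j)) * c m) = 0"
    and y: "\<forall>k\<le>d. (\<Sum>m\<in>monoms d. monom_value m (($) (sympoint (real k) (real k))) * c m) = 0"
    and m: "m \<in> monoms d"
  have "pullback d c a b = 0" for a b
  proof (subst pullback_diagonal)
    show "pullback d c (real i) (real j) = 0" if "i < j" "j \<le> d" for i j
      using assms[OF that] v by (auto simp: pullback_def)
  qed (use y in \<open>simp add: pullback_def\<close>)
  then show "c m = 0" using m by (rule pullback_eq_0)
qed

text \<open>Expanding both slots of \<open>A\<close> by \<open>pullback_diagonal\<close> leaves a
  symmetric matrix \<open>\<beta>\<close> of coefficients. Equal arguments in the two slots turn the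
  multiplication hypothesis into the relation of \<open>lagrange_products_independent\<close>, so
  \<open>\<beta> = 0\<close>, and hence \<open>A = 0\<close>.\<close>

lemma star_square_injective:
  assumes pts: "\<And>i j. i < j \<Longrightarrow> j \<le> d \<Longrightarrow> \<exists>n<s. v n = sympoint (real i) (real j)"
  shows "square_injective d s v"
  unfolding square_injective_def
proof (intro allI impI)
  fix A :: "(3 \<Rightarrow>\<^sub>0 nat) \<times> (3 \<Rightarrow>\<^sub>0 nat) \<Rightarrow> real"
  assume symA: "\<forall>m\<in>monoms d. \<forall>m'\<in>monoms d. A (m, m') = A (m', m)"
    and ker: "\<forall>j<s. \<forall>m\<in>monoms d. (\<Sum>m'\<in>monoms d. monom_value m' (($) (v j)) * A (m, m')) = 0"
    and mult: "\<forall>x. (\<Sum>(m, m')\<in>monoms d \<times> monoms d. monom_value m (($) x) * monom_value m' (($) x) * A (m, m')) = 0"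
  \<comment> \<open>The diagonal coefficients of the second slot, still a coefficient function in
    the first; \<open>\<beta>\<close> then does the same for the first slot.\<close>
  define g where "g = (\<lambda>l m. pullback d (\<lambda>m'. A (m, m')) (real l) (real l))"
  have ker_nodes: "pullback d (\<lambda>m'. A (m, m')) (real i) (real j) = 0" if "m \<in> monoms d" "i < j" "j \<le> d" for m i j
    using pts[OF that(2,3)] ker that(1) by (auto simp: pullback_def)
  have swap: "pullback d (\<lambda>m. pullback d (\<lambda>m'. A (m, m')) a' b') a b =
      pullback d (\<lambda>m. pullback d (\<lambda>m'. A (m, m')) a b) a' b'" for a b a' b'
  proof -
    have "pullback d (\<lambda>m. pullback d (\<lambda>m'. A (m, m')) a' b') a b =
      (\<Sum>m\<in>monoms d. \<Sum>m'\<in>monoms d. monom_value m' (($) (sympoint a' b')) * (monom_value m (($) (sympoint a b)) * A (m, m')))"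
      by (simp add: pullback_def sum_distrib_left mult_ac)
    also have "\<dots> = (\<Sum>m'\<in>monoms d. \<Sum>m\<in>monoms d. monom_value m' (($) (sympoint a' b')) * (monom_value m (($) (sympoint a b)) * A (m', m)))"
    proof (subst sum.swap, intro sum.cong refl)
      fix m m' :: "3 \<Rightarrow>\<^sub>0 nat" assume "m' \<in> monoms d" "m \<in> monoms d"
      then have "A (m, m') = A (m', m)" using symA by blast
      then show "monom_value m' (($) (sympoint a' b')) * (monom_value m (($) (sympoint a b)) * A (m, m')) =
          monom_value m' (($) (sympoint a' b')) * (monom_value m (($) (sympoint a b)) * A (m', m))"
        by (rule arg_cong)
    qed
    finally show ?thesis by (simp add: pullback_def sum_distrib_left)
  qed
  have g_nodes: "pullback d (g l) (real i) (real j) = 0" if "i < j" "j \<le> d" for l i j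
    unfolding g_def by (subst swap, subst pullback_def) (simp add: ker_nodes that)
  define \<beta> where "\<beta> = (\<lambda>k l. pullback d (g l) (real k) (real k))"
  have \<beta>: "\<beta> k l = 0" if "k \<le> d" "l \<le> d" for k l
  proof (rule lagrange_products_independent[OF _ _ that])
    show "\<beta> k l = \<beta> l k" for k l
      unfolding \<beta>_def g_def by (rule swap)
    fix a b
    let ?L = "\<lambda>k. poly (lagrange d k)"
    have "0 = pullback d (\<lambda>m. pullback d (\<lambda>m'. A (m, m')) a b) a b"
      using spec[OF mult, of "sympoint a b"]
      unfolding pullback_def sum_distrib_left sum.cartesian_product[symmetric] mult.assoc by (rule sym)
    also have "\<dots> = pullback d (\<lambda>m. \<Sum>l\<le>d. g l m * ?L l a * ?L l b) a b"
    proof -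
      have "pullback d (\<lambda>m'. A (m, m')) a b = (\<Sum>l\<le>d. g l m * ?L l a * ?L l b)" if "m \<in> monoms d" for m
        unfolding g_def by (rule pullback_diagonal) (rule ker_nodes[OF that])
      then show ?thesis
        unfolding pullback_def[of d "\<lambda>m. pullback d (\<lambda>m'. A (m, m')) a b"] pullback_def[of d "\<lambda>m. \<Sum>l\<le>d. g l m * ?L l a * ?L l b"]
        by (intro sum.cong) simp_all
    qed
    also have "\<dots> = (\<Sum>l\<le>d. pullback d (g l) a b * ?L l a * ?L l b)"
      unfolding pullback_def sum_distrib_left sum_distrib_right
      by (subst sum.swap) (simp add: mult_ac)
    also have "\<dots> = (\<Sum>l\<le>d. (\<Sum>k\<le>d. \<beta> k l * ?L k a * ?L k b) * ?L l a * ?L l b)"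
      unfolding \<beta>_def by (intro sum.cong refl arg_cong2[of _ _ _ _ "(*)"] pullback_diagonal g_nodes)
    also have "\<dots> = (\<Sum>k\<le>d. \<Sum>l\<le>d. \<beta> k l * (?L k a * ?L l a) * (?L k b * ?L l b))"
      unfolding sum_distrib_right by (subst sum.swap) (simp add: mult_ac)
    finally show "(\<Sum>k\<le>d. \<Sum>l\<le>d. \<beta> k l * (?L k a * ?L l a) * (?L k b * ?L l b)) = 0" by simp
  qed
  show "\<forall>m\<in>monoms d. \<forall>m'\<in>monoms d. A (m, m') = 0"
  proof (intro ballI)
    fix m m' :: "3 \<Rightarrow>\<^sub>0 nat" assume m: "m \<in> monoms d" "m' \<in> monoms d"
    \<comment> \<open>The two expansions are undone in turn: \<open>\<beta> = 0\<close> gives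
      \<open>g = 0\<close>, and this gives \<open>A = 0\<close>.\<close>
    have "g l m = 0" if "l \<le> d" for l
    proof (rule pullback_eq_0[OF _ m(1)])
      show "pullback d (g l) a b = 0" for a b
        by (subst pullback_diagonal) (use g_nodes \<beta> that in \<open>simp_all add: \<beta>_def\<close>)
    qed
    then have "pullback d (\<lambda>m'. A (m, m')) a b = 0" for a b
      by (subst pullback_diagonal) (use ker_nodes m in \<open>simp_all add: g_def\<close>)
    then show "A (m, m') = 0" by (rule pullback_eq_0[OF _ m(2)])
  qed
qed

section \<open>Counting star points and monomials\<close>

lemma card_increasing_pairs: "card {(i, j). i < j \<and> j \<le> (d::nat)} = (d + 1) choose 2"
proof -
  have "{(i, j). i < j \<and> j \<le> d} = prod.swap ` (SIGMA j:{..d}. {..<j})" by auto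
  then have "card {(i, j). i < j \<and> j \<le> d} = card (SIGMA j:{..d}. {..<j})"
    by (simp add: card_image)
  also have "\<dots> = \<Sum>{..d}" by simp
  also have "\<dots> = (d + 1) choose 2"
    by (simp add: choose_two gauss_sum_nat atMost_atLeast0 mult.commute)
  finally show ?thesis .
qed

lemma card_monoms_3: "card (monoms d :: (3 \<Rightarrow>\<^sub>0 nat) set) = ((d + 1) choose 2) + (d + 1)"
proof -
  \<comment> \<open>Partial sums of the exponents encode a monomial; the \<open>Suc\<close> makes
    the pair strictly increasing. Pascal's rule then splits off the \<open>d + 1\<close> auxiliary
    points.\<close>
  let ?f = "\<lambda>m :: 3 \<Rightarrow>\<^sub>0 nat. (Poly_Mapping.lookup m 1, Suc (Poly_Mapping.lookup m 1 + Poly_Mapping.lookup m 2))"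
  have "bij_betw ?f (monoms d) {(i, j). i < j \<and> j \<le> d + 1}"
    unfolding bij_betw_def
  proof
    show "inj_on ?f (monoms d)"
    proof (rule inj_onI, rule poly_mapping_eqI)
      fix m m' :: "3 \<Rightarrow>\<^sub>0 nat" and k :: 3
      assume "m \<in> monoms d" "m' \<in> monoms d" "?f m = ?f m'"
      then show "Poly_Mapping.lookup m k = Poly_Mapping.lookup m' k"
        using exhaust_3[of k] by (auto simp: monoms_3)
    qed
    show "?f ` monoms d = {(i, j). i < j \<and> j \<le> d + 1}"
    proof (intro subset_antisym subsetI)
      fix p assume "p \<in> {(i, j). i < j \<and> j \<le> d + 1}"
      then obtain i j where p: "p = (i, j)" "i < j" "j \<le> d + 1" by auto
      let ?m = "Poly_Mapping.single 1 i + Poly_Mapping.single 2 (j - i - 1) + Poly_Mapping.single (3::3) (d + 1 - j)"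
      have "?m \<in> monoms d" "?f ?m = p"
        using p by (auto simp: monoms_3 lookup_add lookup_single)
      then show "p \<in> ?f ` monoms d" by blast
    qed (auto simp: monoms_3)
  qed
  then have "card (monoms d :: (3 \<Rightarrow>\<^sub>0 nat) set) = (d + 1 + 1) choose 2"
    by (simp only: bij_betw_same_card card_increasing_pairs)
  then show ?thesis by (simp add: numeral_2_eq_2)
qed

section \<open>Openness of the conditions on the points\<close>

text \<open>The multidegree is a parameter here, while \<open>multihomogeneous\<close> quantifies it
  away: differences stay multihomogeneous only within a common multidegree.\<close>

definition multihomogeneous_map :: "nat \<Rightarrow> (nat \<Rightarrow> nat) \<Rightarrow> ((nat \<Rightarrow> real ^ 'n::finite) \<Rightarrow> real) \<Rightarrow> bool" where
  "multihomogeneous_map s \<delta> F \<longleftrightarrow> (\<exists>q.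
     (\<forall>m\<in>Poly_Mapping.keys q. Poly_Mapping.keys m \<subseteq> {..<s} \<times> UNIV \<and>
        (\<forall>j<s. (\<Sum>i\<in>UNIV. Poly_Mapping.lookup m (j, i)) = \<delta> j)) \<and>
     (\<forall>v. poly_value q (\<lambda>(j, i). v j $ i) = F v))"

lemma multihomogeneous_mapE:
  assumes "multihomogeneous_map s \<delta> F"
  obtains q where "multihomogeneous s q" "\<And>v. poly_value q (\<lambda>(j, i). v j $ i) = F v"
proof -
  obtain q where q: "\<forall>m\<in>Poly_Mapping.keys q. Poly_Mapping.keys m \<subseteq> {..<s} \<times> UNIV \<and>
        (\<forall>j<s. (\<Sum>i\<in>UNIV. Poly_Mapping.lookup m (j, i)) = \<delta> j)"
      "\<And>v. poly_value q (\<lambda>(j, i). v j $ i) = F v"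
    using assms unfolding multihomogeneous_map_def by blast
  have "multihomogeneous s q"
    unfolding multihomogeneous_def using q(1) by (rule exI[of _ \<delta>])
  then show ?thesis using q(2) by (rule that)
qed

lemma multihomogeneous_map_const: "multihomogeneous_map s (\<lambda>_. 0) (\<lambda>_. a)"
  unfolding multihomogeneous_map_def
  by (rule exI[of _ "Poly_Mapping.single 0 a"]) (simp add: poly_value_single)

lemma multihomogeneous_map_if:
  assumes "multihomogeneous_map s \<delta> F"
  shows "multihomogeneous_map s \<delta> (\<lambda>v. if P then F v else 0)"
proof -
  have "multihomogeneous_map s \<delta> (\<lambda>_. 0)"
    unfolding multihomogeneous_map_def by (rule exI[of _ 0]) simp
  with assms show ?thesis by (cases P) simp_all
qed

lemma multihomogeneous_map_diff:
  assumes "multihomogeneous_map s \<delta> F" "multihomogeneous_map s \<delta> G"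
  shows "multihomogeneous_map s \<delta> (\<lambda>v. F v - G v)"
proof -
  let ?ok = "\<lambda>q. \<forall>m\<in>Poly_Mapping.keys q. Poly_Mapping.keys m \<subseteq> {..<s} \<times> UNIV \<and>
        (\<forall>j<s. (\<Sum>i\<in>UNIV. Poly_Mapping.lookup m (j, i)) = \<delta> j)"
  obtain p where p: "?ok p" "\<And>v. poly_value p (\<lambda>(j, i). v j $ i) = F v"
    using assms(1) unfolding multihomogeneous_map_def by blast
  obtain q where q: "?ok q" "\<And>v. poly_value q (\<lambda>(j, i). v j $ i) = G v"
    using assms(2) unfolding multihomogeneous_map_def by blast
  have "Poly_Mapping.keys (p - q) \<subseteq> Poly_Mapping.keys p \<union> Poly_Mapping.keys q"
    by (auto simp: in_keys_iff lookup_minus)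
  then have "?ok (p - q)" using p(1) q(1) by blast
  moreover have "poly_value (p - q) (\<lambda>(j, i). v j $ i) = F v - G v" for v
    by (simp add: poly_value_diff p q)
  ultimately show ?thesis unfolding multihomogeneous_map_def by blast
qed

lemma multihomogeneous_map_mult:
  assumes "multihomogeneous_map s \<delta> F" "multihomogeneous_map s \<epsilon> G"
  shows "multihomogeneous_map s (\<lambda>j. \<delta> j + \<epsilon> j) (\<lambda>v. F v * G v)"
proof -
  let ?ok = "\<lambda>\<delta> m. Poly_Mapping.keys m \<subseteq> {..<s} \<times> UNIV \<and>
        (\<forall>j<s. (\<Sum>i\<in>UNIV. Poly_Mapping.lookup m (j, i)) = (\<delta> j :: nat))"
  obtain p where p: "\<forall>m\<in>Poly_Mapping.keys p. ?ok \<delta> m" "\<And>v. poly_value p (\<lambda>(j, i). v j $ i) = F v"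
    using assms(1) unfolding multihomogeneous_map_def by blast
  obtain q where q: "\<forall>m\<in>Poly_Mapping.keys q. ?ok \<epsilon> m" "\<And>v. poly_value q (\<lambda>(j, i). v j $ i) = G v"
    using assms(2) unfolding multihomogeneous_map_def by blast
  have "?ok (\<lambda>j. \<delta> j + \<epsilon> j) m" if m: "m \<in> Poly_Mapping.keys (p * q)" for m
  proof -
    obtain a b where ab: "a \<in> Poly_Mapping.keys p" "b \<in> Poly_Mapping.keys q" "m = a + b"
      using m keys_mult[of p q] by blast
    then have "?ok \<delta> a" "?ok \<epsilon> b" using p(1) q(1) by blast+
    then show ?thesis
      using keys_add[of a b] by (auto simp: ab(3) lookup_add sum.distrib)
  qed
  moreover have "poly_value (p * q) (\<lambda>(j, i). v j $ i) = F v * G v" for v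
    by (simp add: poly_value_mult p q)
  ultimately show ?thesis unfolding multihomogeneous_map_def by blast
qed

lemma multihomogeneous_map_monom:
  fixes m :: "'n::finite \<Rightarrow>\<^sub>0 nat"
  assumes "m \<in> monoms d" "j < s"
  shows "multihomogeneous_map s (\<lambda>j'. if j' = j then d else 0) (\<lambda>v. monom_value m (($) (v j)))"
proof -
  \<comment> \<open>The monomial \<open>m\<close> with each variable \<open>i\<close> renamed to
    \<open>(j, i)\<close>.\<close>
  define e where "e = (\<Sum>i\<in>Poly_Mapping.keys m. Poly_Mapping.single (j, i) (Poly_Mapping.lookup m i))"
  have e: "Poly_Mapping.lookup e (j', i) = (if j' = j then Poly_Mapping.lookup m i else 0)" for j' i
    by (auto simp: e_def lookup_sum lookup_single when_def in_keys_iff)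
  have keys: "Poly_Mapping.keys e = Pair j ` Poly_Mapping.keys m"
    by (auto simp: in_keys_iff e split: if_splits)
  have "monom_value e (\<lambda>(j, i). v j $ i) = monom_value m (($) (v j))" for v :: "nat \<Rightarrow> real ^ 'n"
    unfolding keys by (subst prod.reindex) (auto simp: inj_on_def e)
  then show ?thesis
    unfolding multihomogeneous_map_def using assms
    by (intro exI[of _ "Poly_Mapping.single e 1"]) (auto simp: poly_value_single e keys monoms_def)
qed

lemma ball_Plus: "(\<forall>i\<in>A <+> B. P i) \<longleftrightarrow> (\<forall>a\<in>A. P (Inl a)) \<and> (\<forall>b\<in>B. P (Inr b))"
  by blast

text \<open>With \<open>y\<close> fixed, the rows for \<open>y\<close> are constants of multidegree
  zero and the row for \<open>v j\<close> has degree \<open>d\<close> in the \<open>j\<close>-th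
  vector, so elimination yields \<open>D\<close>.\<close>

lemma unisolvent_open:
  fixes v\<^sub>0 y :: "nat \<Rightarrow> real ^ 'n::finite"
  assumes "unisolvent d s v\<^sub>0 y"
  obtains \<delta> D where "multihomogeneous_map s \<delta> D" "D v\<^sub>0 \<noteq> 0"
    "\<And>v. D v \<noteq> 0 \<Longrightarrow> unisolvent d s v y"
proof -
  define I where "I = {..<s} <+> {..d}"
  define c where "c = (\<lambda>i m (v :: nat \<Rightarrow> real ^ 'n). monom_value m (($) (case_sum v y i)))"
  have rows: "(\<forall>i\<in>I. (\<Sum>m\<in>monoms d. c i m v * x m) = 0) \<longleftrightarrow>
      (\<forall>j<s. (\<Sum>m\<in>monoms d. monom_value m (($) (v j)) * x m) = 0) \<and>
      (\<forall>k\<le>d. (\<Sum>m\<in>monoms d. monom_value m (($) (y k)) * x m) = 0)" for v x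
    unfolding I_def c_def ball_Plus by (simp only: sum.case Ball_def lessThan_iff atMost_iff)
  have "\<exists>e D. multihomogeneous_map s e D \<and> D v\<^sub>0 \<noteq> 0 \<and> (\<forall>v x. D v \<noteq> 0 \<longrightarrow>
      (\<forall>i\<in>I. (\<Sum>m\<in>monoms d. c i m v * x m) = 0) \<longrightarrow> (\<forall>m\<in>monoms d. x m = 0))"
  proof (rule elimination_nonsingular[where \<delta> = "case_sum (\<lambda>j j'. if j' = j then d else 0) (\<lambda>_ _. 0)"])
    fix i m assume "i \<in> I" "m \<in> (monoms d :: ('n \<Rightarrow>\<^sub>0 nat) set)"
    then show "multihomogeneous_map s (case_sum (\<lambda>j j'. if j' = j then d else 0) (\<lambda>_ _. 0) i) (c i m)"
      by (auto simp: I_def c_def multihomogeneous_map_monom multihomogeneous_map_const)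
  next
    fix x assume "\<And>i. i \<in> I \<Longrightarrow> (\<Sum>m\<in>monoms d. c i m v\<^sub>0 * x m) = 0"
    then have "\<forall>i\<in>I. (\<Sum>m\<in>monoms d. c i m v\<^sub>0 * x m) = 0" by blast
    then show "\<forall>m\<in>monoms d. x m = 0"
      unfolding rows by (intro unisolventD[OF assms]) auto
  qed (rule multihomogeneous_map_const multihomogeneous_map_mult multihomogeneous_map_diff finite_monoms; assumption?)+
  then obtain e D where D: "multihomogeneous_map s e D" "D v\<^sub>0 \<noteq> 0"
    "\<And>v x. D v \<noteq> 0 \<Longrightarrow> (\<forall>i\<in>I. (\<Sum>m\<in>monoms d. c i m v * x m) = 0) \<Longrightarrow> (\<forall>m\<in>monoms d. x m = 0)"
    by blast
  show ?thesis
  proof (rule that[OF D(1,2)])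
    fix v assume "D v \<noteq> 0"
    from D(3)[OF this] show "unisolvent d s v y"
      unfolding rows unisolvent_def by blast
  qed
qed

text \<open>The entries of \<open>A\<close> are the unknowns of a homogeneous linear system. Its
  only rows that depend on \<open>v\<close> express that \<open>A\<close> annihilates the evaluation
  vectors.\<close>

lemma square_injective_open:
  fixes v\<^sub>0 :: "nat \<Rightarrow> real ^ 'n::finite"
  assumes "square_injective d s v\<^sub>0"
  obtains \<delta> D where "multihomogeneous_map s \<delta> D" "D v\<^sub>0 \<noteq> 0"
    "\<And>v. D v \<noteq> 0 \<Longrightarrow> square_injective d s v"
proof -
  define J where "J = (monoms d \<times> monoms d :: (('n \<Rightarrow>\<^sub>0 nat) \<times> ('n \<Rightarrow>\<^sub>0 nat)) set)"
  define I where "I = J <+> (({..<s} \<times> (monoms d :: ('n \<Rightarrow>\<^sub>0 nat) set)) <+> (UNIV :: (real ^ 'n) set))"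
  \<comment> \<open>The three kinds of rows: symmetry of \<open>A\<close>, annihilation of the
    evaluation vectors, and vanishing of the product at each point \<open>x\<close>.\<close>
  define c where "c = (\<lambda>i p (v :: nat \<Rightarrow> real ^ 'n). case i of
      Inl m \<Rightarrow> (if p = m then 1 else 0) - (if p = prod.swap m then 1 else 0)
    | Inr (Inl (j, m)) \<Rightarrow> if fst p = m then monom_value (snd p) (($) (v j)) else 0
    | Inr (Inr x) \<Rightarrow> monom_value (fst p) (($) x) * monom_value (snd p) (($) x))"
  define \<delta> :: "('n \<Rightarrow>\<^sub>0 nat) \<times> ('n \<Rightarrow>\<^sub>0 nat) + nat \<times> ('n \<Rightarrow>\<^sub>0 nat) + real ^ 'n \<Rightarrow> nat \<Rightarrow> nat"
    where "\<delta> = case_sum (\<lambda>_ _. 0) (case_sum (\<lambda>(j, m) j'. if j' = j then d else 0) (\<lambda>_ _. 0))"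
  have finJ: "finite J" by (simp add: J_def)
  have row1: "(\<Sum>p\<in>J. c (Inl (m, m')) p v * A p) = A (m, m') - A (m', m)" if "(m, m') \<in> J" for m m' v A
  proof -
    have "((if P then 1 else 0) - (if Q then 1 else 0)) * a = (if P then a else 0) - (if Q then a else 0)"
      for P Q and a :: real
      by simp
    then have "(\<Sum>p\<in>J. c (Inl (m, m')) p v * A p) =
        (\<Sum>p\<in>J. (if p = (m, m') then A p else 0) - (if p = (m', m) then A p else 0))"
      by (simp only: c_def sum.case swap_simp)
    moreover have "(m', m) \<in> J" using that by (simp add: J_def)
    ultimately show ?thesis
      using that by (simp only: sum_subtractf sum.delta[OF finJ] if_True)
  qed
  have row2: "(\<Sum>p\<in>J. c (Inr (Inl (j, m))) p v * A p) =
      (\<Sum>m'\<in>monoms d. monom_value m' (($) (v j)) * A (m, m'))" if "m \<in> monoms d" for j m v A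
  proof -
    have "(\<Sum>p\<in>J. c (Inr (Inl (j, m))) p v * A p) =
        (\<Sum>n\<in>monoms d. if n = m then (\<Sum>m'\<in>monoms d. monom_value m' (($) (v j)) * A (m, m')) else 0)"
      unfolding J_def sum.cartesian_product' by (intro sum.cong refl) (auto simp: c_def)
    then show ?thesis using that by simp
  qed
  have row3: "(\<Sum>p\<in>J. c (Inr (Inr x)) p v * A p) =
      (\<Sum>(m, m')\<in>monoms d \<times> monoms d. monom_value m (($) x) * monom_value m' (($) x) * A (m, m'))" for x v A
    by (simp add: c_def J_def case_prod_unfold)
  have rows: "(\<forall>i\<in>I. (\<Sum>p\<in>J. c i p v * A p) = 0) \<longleftrightarrow>
     (\<forall>m\<in>monoms d. \<forall>m'\<in>monoms d. A (m, m') = A (m', m)) \<and>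
     (\<forall>j<s. \<forall>m\<in>monoms d. (\<Sum>m'\<in>monoms d. monom_value m' (($) (v j)) * A (m, m')) = 0) \<and>
     (\<forall>x. (\<Sum>(m, m')\<in>monoms d \<times> monoms d. monom_value m (($) x) * monom_value m' (($) x) * A (m, m')) = 0)" for v A
  proof -
    have "(\<forall>i\<in>I. (\<Sum>p\<in>J. c i p v * A p) = 0) \<longleftrightarrow>
      (\<forall>m\<in>monoms d. \<forall>m'\<in>monoms d. (\<Sum>p\<in>J. c (Inl (m, m')) p v * A p) = 0) \<and>
      (\<forall>j<s. \<forall>m\<in>monoms d. (\<Sum>p\<in>J. c (Inr (Inl (j, m))) p v * A p) = 0) \<and>
      (\<forall>x. (\<Sum>p\<in>J. c (Inr (Inr x)) p v * A p) = 0)"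
      unfolding I_def J_def ball_Plus split_paired_Ball_Sigma
      by (simp only: Ball_def lessThan_iff UNIV_I simp_thms)
    moreover have "(\<Sum>p\<in>J. c (Inl (m, m')) p v * A p) = 0 \<longleftrightarrow> A (m, m') = A (m', m)"
      if "m \<in> monoms d" "m' \<in> monoms d" for m m'
      using that by (subst row1) (auto simp: J_def)
    ultimately show ?thesis by (simp add: row2 row3)
  qed
  have "\<exists>e D. multihomogeneous_map s e D \<and> D v\<^sub>0 \<noteq> 0 \<and> (\<forall>v A. D v \<noteq> 0 \<longrightarrow>
      (\<forall>i\<in>I. (\<Sum>p\<in>J. c i p v * A p) = 0) \<longrightarrow> (\<forall>p\<in>J. A p = 0))"
  proof (rule elimination_nonsingular[where \<delta> = \<delta>])
    fix i p assume "i \<in> I" "p \<in> J"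
    then show "multihomogeneous_map s (\<delta> i) (c i p)"
      by (auto simp: I_def J_def c_def \<delta>_def multihomogeneous_map_monom multihomogeneous_map_const
          intro!: multihomogeneous_map_if)
  next
    fix A assume "\<And>i. i \<in> I \<Longrightarrow> (\<Sum>p\<in>J. c i p v\<^sub>0 * A p) = 0"
    then have "\<forall>i\<in>I. (\<Sum>p\<in>J. c i p v\<^sub>0 * A p) = 0" by blast
    then have "\<forall>m\<in>monoms d. \<forall>m'\<in>monoms d. A (m, m') = 0"
      unfolding rows by (intro square_injectiveD[OF assms]) auto
    then show "\<forall>p\<in>J. A p = 0" by (auto simp: J_def)
  qed (rule multihomogeneous_map_const multihomogeneous_map_mult multihomogeneous_map_diff finJ; assumption?)+
  then obtain e D where D: "multihomogeneous_map s e D" "D v\<^sub>0 \<noteq> 0"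
    "\<And>v A. D v \<noteq> 0 \<Longrightarrow> (\<forall>i\<in>I. (\<Sum>p\<in>J. c i p v * A p) = 0) \<Longrightarrow> (\<forall>p\<in>J. A p = 0)"
    by blast
  show ?thesis
  proof (rule that[OF D(1,2)])
    fix v assume "D v \<noteq> 0"
    show "square_injective d s v"
      unfolding square_injective_def
    proof (intro allI impI)
      fix A :: "('n \<Rightarrow>\<^sub>0 nat) \<times> ('n \<Rightarrow>\<^sub>0 nat) \<Rightarrow> real"
      assume "\<forall>m\<in>monoms d. \<forall>m'\<in>monoms d. A (m, m') = A (m', m)"
        and "\<forall>j<s. \<forall>m\<in>monoms d. (\<Sum>m'\<in>monoms d. monom_value m' (($) (v j)) * A (m, m')) = 0"
        and "\<forall>x. (\<Sum>(m, m')\<in>monoms d \<times> monoms d. monom_value m (($) x) * monom_value m' (($) x) * A (m, m')) = 0"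
      then have "\<forall>i\<in>I. (\<Sum>p\<in>J. c i p v * A p) = 0"
        unfolding rows by (intro conjI)
      then have "\<forall>p\<in>J. A p = 0" by (rule D(3)[OF \<open>D v \<noteq> 0\<close>])
      then show "\<forall>m\<in>monoms d. \<forall>m'\<in>monoms d. A (m, m') = 0"
        unfolding J_def split_paired_Ball_Sigma .
    qed
  qed
qed

section \<open>Projective points and the conclusion\<close>

lemma vanishes_at_line:
  assumes "f \<in> forms e" "L \<in> proj_space" "u \<in> L - {0}"
  shows "vanishes_at f L \<longleftrightarrow> poly_value f (($) u) = 0"
proof -
  have "span {u} = L"
    using assms(2,3) by (intro subspace_dim_equal) (auto simp: proj_space_def span_minimal)
  have "vanishes_at f L" if zero: "poly_value f (($) u) = 0"
    unfolding vanishes_at_def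
  proof
    fix x assume "x \<in> L"
    then obtain t where "x = t *\<^sub>R u" using \<open>span {u} = L\<close> by (auto simp: span_singleton)
    then have "($) x = (\<lambda>i. t * u $ i)" by auto
    then show "poly_value f (\<lambda>i. x $ i) = 0"
      using poly_value_forms_scale[OF assms(1), of t "($) u"] zero by simp
  qed
  then show ?thesis using assms(3) by (auto simp: vanishes_at_def)
qed

theorem corollary3p5:
  fixes d :: nat
  assumes "d \<ge> 2"
  shows "for_general_points ((d + 1) choose 2)
           (\<lambda>z :: nat \<Rightarrow> (real ^ 3) set.
              for_general_sos d (z ` {..<(d + 1) choose 2})
                (\<lambda>f. sos_length d f = d + 1))
         \<and> sos_length_sup TYPE(3) d \<ge> enat (d + 1)"
proof -
  define s where "s = (d + 1) choose 2"
  have "finite {(i, j). i < j \<and> j \<le> d}"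
    by (rule finite_subset[of _ "{..d} \<times> {..d}"]) auto
  then obtain h where h: "bij_betw h {..<s} {(i, j). i < j \<and> j \<le> d}"
    using ex_bij_betw_nat_finite unfolding s_def card_increasing_pairs[symmetric] lessThan_atLeast0
    by blast
  \<comment> \<open>The star configuration: the pairwise intersections of the \<open>d + 1\<close>
    lines, enumerated by \<open>h\<close>.\<close>
  define v\<^sub>0 where "v\<^sub>0 = (\<lambda>n. sympoint (real (fst (h n))) (real (snd (h n))))"
  define y where "y = (\<lambda>k. sympoint (real k) (real k))"
  have pts: "\<exists>n<s. v\<^sub>0 n = sympoint (real i) (real j)" if "i < j" "j \<le> d" for i j
  proof -
    have "(i, j) \<in> h ` {..<s}" using h that by (simp add: bij_betw_def)
    then obtain n where "n < s" "h n = (i, j)" by fastforce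
    then show ?thesis by (intro exI[of _ n]) (simp add: v\<^sub>0_def)
  qed
  obtain \<delta>\<^sub>1 D\<^sub>1 where D\<^sub>1: "multihomogeneous_map s \<delta>\<^sub>1 D\<^sub>1" "D\<^sub>1 v\<^sub>0 \<noteq> 0"
    "\<And>v. D\<^sub>1 v \<noteq> 0 \<Longrightarrow> unisolvent d s v y"
    using unisolvent_open[OF star_unisolvent[OF pts]] unfolding y_def by blast
  obtain \<delta>\<^sub>2 D\<^sub>2 where D\<^sub>2: "multihomogeneous_map s \<delta>\<^sub>2 D\<^sub>2" "D\<^sub>2 v\<^sub>0 \<noteq> 0"
    "\<And>v. D\<^sub>2 v \<noteq> 0 \<Longrightarrow> square_injective d s v"
    using square_injective_open[OF star_square_injective[OF pts]] by blast
  \<comment> \<open>The product makes both conditions hold wherever \<open>q\<close> is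
    nonzero.\<close>
  obtain q where q: "multihomogeneous s q"
    "\<And>v. poly_value q (\<lambda>(j, i). v j $ i) = D\<^sub>1 v * D\<^sub>2 v"
    by (rule multihomogeneous_mapE[OF multihomogeneous_map_mult[OF D\<^sub>1(1) D\<^sub>2(1)]]) (rule that)
  define U where "U = {z \<in> proj_tuples s. \<not> vanishes_at_tuple s q z}"
  have "proj_tuples s - U = {z \<in> proj_tuples s. \<forall>p\<in>{q}. vanishes_at_tuple s p z}"
    by (auto simp: U_def)
  then have "zariski_closed_tuples s (proj_tuples s - U)"
    unfolding zariski_closed_tuples_def using q(1) by blast
  then have "zariski_open_tuples s U"
    by (auto simp: zariski_open_tuples_def U_def)
  moreover have U_ne: "U \<noteq> {}"
  proof -
    define z\<^sub>0 where "z\<^sub>0 = restrict (\<lambda>j. span {v\<^sub>0 j}) {..<s}"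
    have v\<^sub>0: "v\<^sub>0 j \<noteq> 0" for j
    proof
      assume "v\<^sub>0 j = 0"
      then have "v\<^sub>0 j $ 3 = 0" by simp
      then show False by (simp add: v\<^sub>0_def sympoint_def)
    qed
    then have "z\<^sub>0 \<in> proj_tuples s"
      by (auto simp: z\<^sub>0_def proj_tuples_def proj_space_def)
    moreover have "\<not> vanishes_at_tuple s q z\<^sub>0"
      unfolding vanishes_at_tuple_def q(2) using D\<^sub>1(2) D\<^sub>2(2) v\<^sub>0
      by (auto simp: z\<^sub>0_def intro!: exI[of _ v\<^sub>0] span_base)
    ultimately show ?thesis by (auto simp: U_def)
  qed
  moreover have general: "\<exists>A f\<^sub>0. algebraic_subset (span (sos_vanishing d (z ` {..<s}))) A \<and>
      f\<^sub>0 \<in> sos_vanishing d (z ` {..<s}) - A \<and>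
      (\<forall>f \<in> sos_vanishing d (z ` {..<s}) - A. sos_length d f = d + 1)" if z: "z \<in> U" for z
  proof -
    \<comment> \<open>That \<open>q\<close> does not vanish at \<open>z\<close> gives one system of
      representatives where both pivot products are nonzero.\<close>
    obtain v where v: "\<And>j. j < s \<Longrightarrow> v j \<in> z j - {0}" "D\<^sub>1 v \<noteq> 0" "D\<^sub>2 v \<noteq> 0"
      using z unfolding U_def vanishes_at_tuple_def q(2) by auto
    have line: "z j \<in> proj_space" if "j < s" for j
      using z that by (auto simp: U_def proj_tuples_def)
    have Z: "(\<forall>L\<in>z ` {..<s}. vanishes_at f L) \<longleftrightarrow> (\<forall>j<s. poly_value f (($) (v j)) = 0)"
      if "f \<in> forms e" for f e
    proof -
      have "vanishes_at f (z j) \<longleftrightarrow> poly_value f (($) (v j)) = 0" if "j \<in> {..<s}" for j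
        using that by (intro vanishes_at_line[OF \<open>f \<in> forms e\<close> line v(1)]) auto
      then have "(\<forall>j\<in>{..<s}. vanishes_at f (z j)) \<longleftrightarrow> (\<forall>j\<in>{..<s}. poly_value f (($) (v j)) = 0)"
        by (rule ball_cong[OF refl])
      then show ?thesis unfolding ball_simps by (simp only: Ball_def lessThan_iff)
    qed
    show ?thesis
      by (rule general_sos_length[OF D\<^sub>1(3)[OF v(2)] card_monoms_3[of d, folded s_def] D\<^sub>2(3)[OF v(3)]]) (erule Z, intro exI conjI)
  qed
  moreover have "for_general_sos d (z ` {..<s}) (\<lambda>f. sos_length d f = d + 1)" if zU: "z \<in> U" for z
  proof -
    obtain A f\<^sub>0 where "algebraic_subset (span (sos_vanishing d (z ` {..<s}))) A"
      "f\<^sub>0 \<in> sos_vanishing d (z ` {..<s}) - A"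
      "\<forall>f \<in> sos_vanishing d (z ` {..<s}) - A. sos_length d f = d + 1"
      using general[OF zU] by blast
    \<comment> \<open>\<open>f\<^sub>0\<close> lies in the span but not in \<open>A\<close>, so
      \<open>A\<close> is proper.\<close>
    then show ?thesis
      unfolding for_general_sos_def using span_base by (intro exI[of _ A]) blast
  qed
  ultimately have "for_general_points s (\<lambda>z :: nat \<Rightarrow> (real ^ 3) set.
      for_general_sos d (z ` {..<s}) (\<lambda>f. sos_length d f = d + 1))"
    unfolding for_general_points_def by blast
  moreover have "sos_length_sup TYPE(3) d \<ge> enat (d + 1)"
  proof -
    \<comment> \<open>Any configuration in \<open>U\<close> has a sum of squares of length
      \<open>d + 1\<close>, because the exceptional set misses \<open>f\<^sub>0\<close>.\<close>
    obtain z where "z \<in> U" using U_ne by blast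
    from general[OF this] obtain f where f: "f \<in> sos_vanishing d (z ` {..<s})" "sos_length d f = d + 1"
      by blast
    from f(1) have "f \<in> sos_cone d" by (simp add: sos_vanishing_def)
    then have "enat (sos_length d f) \<le> sos_length_sup TYPE(3) d"
      unfolding sos_length_sup_def by (rule SUP_upper)
    then show ?thesis by (simp only: f(2))
  qed
  ultimately show ?thesis by (simp add: s_def)
qed

end
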